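(* (i) The integrality gap of the linear program (PCSF-LP) is at least $9/4$, even when restricted to planar instances of the prize-collecting Steiner forest problem; that is, the supremum, over all instances $\mathcal{J}$ whose graph $G$ is planar and whose LP optimum is positive, of $\mathrm{opt}_{\mathrm{IP}}(\mathcal{J})/\mathrm{opt}_{\mathrm{LP}}(\mathcal{J})$ is at least $9/4$. (ii) Any $\beta$-Lagrangian-multiplier-preserving approximation algorithm for the prize-collecting Steiner forest problem relative to (PCSF-LP) must have $\beta\ge 4$; that is, if $\beta$ is a real number such that for every instance $\mathcal{J}$ (with graph not necessarily planar) there is a forest $F$ in $G$ with $c(F)+\beta\,\pi(F)\le\beta\cdot\mathrm{opt}_{\mathrm{LP}}(\mathcal{J})$, then $\beta\ge 4$.
   Context: An instance $\mathcal{J}$ of the prize-collecting Steiner forest problem (PCSF) consists of a finite undirected graph $G=(V,E)$, edge costs $c_e\ge 0$ for $e\in E$, terminal pairs $(s_1,t_1),\dots,(s_k,t_k)$ of nodes of $G$, and penalties $\pi_i\ge 0$ for $i=1,\dots,k$. For a forest $F\subseteq E$, $c(F)=\sum_{e\in F}c_e$, and $\pi(F)$ is the sum of $\pi_i$ over all $i$ such that $s_i$ and $t_i$ are not connected in $F$. The goal is to minimize $c(F)+\pi(F)$ over forests $F$; the minimum is denoted $\mathrm{opt}_{\mathrm{IP}}(\mathcal{J})$. For $S\subseteq V$, $\delta(S)$ is the set of edges with exactly one endpoint in $S$, $x(\delta(S))=\sum_{e\in\delta(S)}x_e$, and $i\odot S$ means that $S$ contains exactly one of $s_i,t_i$. The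 linear program (PCSF-LP), with variables $x\in\mathbb{R}^E$ and $z\in\mathbb{R}^k$, is $$\min\ \sum_{e\in E}c_ex_e+\sum_{i=1}^k\pi_iz_i\quad\text{s.t.}\quad x(\delta(S))+z_i\ge 1\ \ \text{for all } S\subseteq V \text{ and all } i \text{ with } i\odot S,\qquad x\ge 0,\ z\ge 0.$$ Its optimal value is denoted $\mathrm{opt}_{\mathrm{LP}}(\mathcal{J})$. A $\beta$-Lagrangian-multiplier-preserving ($\beta$-LMP) approximation algorithm relative to (PCSF-LP) is an algorithm that, on every PCSF instance, returns a forest $F$ with $c(F)+\beta\,\pi(F)\le\beta\cdot\mathrm{opt}_{\mathrm{LP}}$.
   Formalization: In (ii), β is assumed to be positive; for β ≤ 0 the empty forest always satisfies the inequality (since opt_LP is at most the total penalty of the empty forest), so the claim as worded for all real β fails there. *)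

theory Defs
  imports "HOL-Analysis.Analysis"
begin

section \<open>Finite simple graphs\<close>

definition ugraph :: "'v set \<Rightarrow> 'v set set \<Rightarrow> bool" where
  "ugraph V E \<longleftrightarrow> finite V \<and> (\<forall>e\<in>E. e \<subseteq> V \<and> card e = 2)"

definition linked :: "'v set set \<Rightarrow> 'v \<Rightarrow> 'v \<Rightarrow> bool" where
  "linked F u v \<longleftrightarrow> (u, v) \<in> {(a, b). {a, b} \<in> F}\<^sup>*"

definition is_cycle :: "'v set set \<Rightarrow> 'v list \<Rightarrow> bool" where
  "is_cycle F vs \<longleftrightarrow> 3 \<le> length vs \<and> distinct vs \<and>
     (\<forall>i < length vs. {vs ! i, vs ! (Suc i mod length vs)} \<in> F)"

definition forest_in :: "'v set set \<Rightarrow> 'v set set \<Rightarrow> bool" where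
  "forest_in E F \<longleftrightarrow> F \<subseteq> E \<and> (\<nexists>vs. is_cycle F vs)"

text \<open>A drawing in the plane, here the complex plane: \<open>p\<close> places the vertices, and each edge \<open>e\<close> is
  drawn as a simple arc \<open>\<gamma> e\<close> between its endpoints. Two arcs meet only in images of common endpoints,
  and an arc contains no vertex other than its own endpoints.\<close>

definition planar_graph :: "'v set \<Rightarrow> 'v set set \<Rightarrow> bool" where
  "planar_graph V E \<longleftrightarrow> (\<exists>(p :: 'v \<Rightarrow> complex) (\<gamma> :: 'v set \<Rightarrow> real \<Rightarrow> complex).
     inj_on p V \<and>
     (\<forall>e\<in>E. arc (\<gamma> e) \<and> {pathstart (\<gamma> e), pathfinish (\<gamma> e)} = p ` e) \<and>
     (\<forall>e\<in>E. \<forall>v\<in>V. p v \<in> path_image (\<gamma> e) \<longrightarrow> v \<in> e) \<and>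
     (\<forall>e\<in>E. \<forall>e'\<in>E. e \<noteq> e' \<longrightarrow> path_image (\<gamma> e) \<inter> path_image (\<gamma> e') \<subseteq> p ` (e \<inter> e')))"

section \<open>Prize-collecting Steiner forest\<close>

text \<open>The terminal pairs are indexed by \<open>i < npairs J\<close>. Values of \<open>cost\<close> outside the edge set and
  of \<open>src\<close>, \<open>tgt\<close>, \<open>penalty\<close> at larger indices are irrelevant.\<close>

record 'v pcsf =
  verts :: "'v set"
  edges :: "'v set set"
  cost :: "'v set \<Rightarrow> real"
  npairs :: nat
  src :: "nat \<Rightarrow> 'v"
  tgt :: "nat \<Rightarrow> 'v"
  penalty :: "nat \<Rightarrow> real"

definition pcsf_instance :: "'v pcsf \<Rightarrow> bool" where
  "pcsf_instance J \<longleftrightarrow> ugraph (verts J) (edges J) \<and>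
     (\<forall>e\<in>edges J. 0 \<le> cost J e) \<and>
     (\<forall>i < npairs J. src J i \<in> verts J \<and> tgt J i \<in> verts J \<and> 0 \<le> penalty J i)"

definition forest_cost :: "'v pcsf \<Rightarrow> 'v set set \<Rightarrow> real" where
  "forest_cost J F = (\<Sum>e\<in>F. cost J e)"

definition forest_penalty :: "'v pcsf \<Rightarrow> 'v set set \<Rightarrow> real" where
  "forest_penalty J F = (\<Sum>i | i < npairs J \<and> \<not> linked F (src J i) (tgt J i). penalty J i)"

definition opt_IP :: "'v pcsf \<Rightarrow> real" where
  "opt_IP J = Min ((\<lambda>F. forest_cost J F + forest_penalty J F) ` {F. forest_in (edges J) F})"

definition cut :: "'v pcsf \<Rightarrow> 'v set \<Rightarrow> 'v set set" where
  "cut J S = {e \<in> edges J. card (e \<inter> S) = 1}"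

definition separates :: "'v pcsf \<Rightarrow> nat \<Rightarrow> 'v set \<Rightarrow> bool" where
  "separates J i S \<longleftrightarrow> (src J i \<in> S) \<noteq> (tgt J i \<in> S)"

definition lp_feasible :: "'v pcsf \<Rightarrow> ('v set \<Rightarrow> real) \<Rightarrow> (nat \<Rightarrow> real) \<Rightarrow> bool" where
  "lp_feasible J x z \<longleftrightarrow>
     (\<forall>S \<subseteq> verts J. \<forall>i < npairs J. separates J i S \<longrightarrow> 1 \<le> (\<Sum>e\<in>cut J S. x e) + z i) \<and>
     (\<forall>e\<in>edges J. 0 \<le> x e) \<and> (\<forall>i < npairs J. 0 \<le> z i)"

definition lp_value :: "'v pcsf \<Rightarrow> ('v set \<Rightarrow> real) \<Rightarrow> (nat \<Rightarrow> real) \<Rightarrow> real" where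
  "lp_value J x z = (\<Sum>e\<in>edges J. cost J e * x e) + (\<Sum>i<npairs J. penalty J i * z i)"

definition opt_LP :: "'v pcsf \<Rightarrow> real" where
  "opt_LP J = Inf {lp_value J x z | x z. lp_feasible J x z}"

text \<open>The minimum and the infimum above are taken over a finite nonempty set and over a nonempty set
  bounded below, respectively.\<close>

lemma finite_forests:
  assumes "pcsf_instance J"
  shows "finite {F. forest_in (edges J) F}"
proof -
  have "edges J \<subseteq> Pow (verts J)" "finite (verts J)"
    using assms by (auto simp: pcsf_instance_def ugraph_def)
  then have "finite (edges J)"
    using finite_subset by blast
  then show ?thesis
    by (rule finite_subset[rotated, OF finite_Pow_iff[THEN iffD2]]) (auto simp: forest_in_def)
qed

lemma forest_in_empty: "forest_in E {}"
  by (auto simp: forest_in_def is_cycle_def intro!: exI[of _ 0])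

lemma lp_values_nonempty:
  assumes "pcsf_instance J"
  shows "{lp_value J x z | x z. lp_feasible J x z} \<noteq> {}"
proof -
  have "lp_feasible J (\<lambda>_. 0) (\<lambda>_. 1)"
    by (simp add: lp_feasible_def)
  then show ?thesis by blast
qed

lemma lp_values_bdd_below:
  assumes "pcsf_instance J"
  shows "bdd_below {lp_value J x z | x z. lp_feasible J x z}"
  using assms
  by (intro bdd_belowI[of _ 0])
     (auto simp: lp_value_def lp_feasible_def pcsf_instance_def intro!: add_nonneg_nonneg sum_nonneg)

end

theory Submission
  imports Defs "HOL-Library.List_Lexorder" "HOL-Library.Sublist" "HOL-Real_Asymp.Real_Asymp"
begin

text \<open>Take a \<open>d\<close>-regular, \<open>d\<close>-edge-connected multigraph and replace its edges by long paths.
  With \<open>x = 1 / d\<close> on every edge, the original vertices are fully connected in the LP, while an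
  inner vertex of a path has connectivity only \<open>2 / d\<close>. A forest that connects all original
  vertices uses a fraction \<open>\<tau>\<close>, about \<open>2 / d\<close>, of the edges, and thereby already connects the
  same fraction of the inner vertices. To make this useless, glue a fresh copy to every inner
  vertex and iterate to a large depth \<open>m\<close>. Expensive pairs force the original vertices of each copy
  together, and cheap pairs join the global root to each vertex that starts a copy. If \<open>q j\<close> is the fraction of copies at level \<open>j\<close> whose root is connected to the
  global root, then level \<open>j\<close> costs about \<open>\<tau> + (q (j + 1) - \<tau> * q j)\<close>, whose average over the
  levels is \<open>\<tau> + (1 - \<tau>) * q\<close> up to a telescoping error, where \<open>q\<close> is the average of the \<open>q j\<close>.
  Penalties of total weight \<open>1 - \<tau>\<close> thus make every forest pay about \<open>1\<close>, whereas the LP pays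
  about \<open>1 / d + (1 - 2 / d) * (1 - \<tau>)\<close>.

  Long prisms have \<open>d = 3\<close> and \<open>\<tau>\<close> close to \<open>2 / 3\<close>, so the LP value tends to \<open>4 / 9\<close>; the tree
  of copies stays planar, as a two-page book embedding in lexicographic order of the vertices
  shows. For the second bound, scale the penalties by \<open>1 / \<beta>\<close> and use complete graphs with \<open>d\<close>
  tending to infinity.\<close>

section \<open>Connectivity in an edge set\<close>

lemma linked_refl: "linked F u u"
  by (simp add: linked_def)

text \<open>A map that keeps or contracts each edge transports walks. The later connectivity
  arguments each choose such a map: a renaming, a contraction of paths, a projection onto one copy,
  or the collapse of a subtree.\<close>

lemma linked_map:
  assumes "linked F u v"
    and "\<And>a b. {a, b} \<in> F \<Longrightarrow> f a = f b \<or> {f a, f b} \<in> F'"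
  shows "linked F' (f u) (f v)"
proof -
  have "(u, v) \<in> {(a, b). {a, b} \<in> F}\<^sup>*" using assms(1) by (simp add: linked_def)
  then show ?thesis
  proof (induction rule: rtrancl_induct)
    case base then show ?case by (rule linked_refl)
  next
    case (step y z)
    then have "f y = f z \<or> {f y, f z} \<in> F'" using assms(2) by blast
    then show ?case
      using step.IH by (auto simp: linked_def intro: rtrancl_into_rtrancl)
  qed
qed

text \<open>Each vertex of \<open>X\<close> other than \<open>r\<close> owns the last edge of a
  shortest walk from \<open>r\<close>. Two vertices owning the same edge would each be strictly
  closer to \<open>r\<close> than the other.\<close>

lemma card_linked_le:
  assumes fin: "finite F" and X: "\<And>v. v \<in> X \<Longrightarrow> linked F r v"
  shows "card X \<le> card F + 1"
proof -
  define R where "R = {(a, b). {a, b} \<in> F}"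
  define dist where "dist v = (LEAST n. (r, v) \<in> R ^^ n)" for v
  have "\<exists>p. {p, v} \<in> F \<and> dist p < dist v" if v: "v \<in> X - {r}" for v
  proof -
    have "(r, v) \<in> R\<^sup>*" using X[of v] v by (simp add: linked_def R_def)
    then obtain n where "(r, v) \<in> R ^^ n" using rtrancl_imp_relpow by blast
    then have *: "(r, v) \<in> R ^^ dist v" unfolding dist_def by (rule LeastI)
    have "dist v \<noteq> 0"
    proof
      assume "dist v = 0"
      then have "(r, v) \<in> R ^^ 0" using * by simp
      then show False using v by simp
    qed
    then obtain n' where n': "dist v = Suc n'" using not0_implies_Suc by blast
    then obtain p where p: "(r, p) \<in> R ^^ n'" "(p, v) \<in> R" using * by auto
    have "dist p \<le> n'" unfolding dist_def using p(1) by (rule Least_le)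
    then show ?thesis using p(2) n' by (auto simp: R_def)
  qed
  then obtain par where par: "\<And>v. v \<in> X - {r} \<Longrightarrow> {par v, v} \<in> F \<and> dist (par v) < dist v"
    by metis
  have inj: "inj_on (\<lambda>v. {par v, v}) (X - {r})"
  proof (rule inj_onI)
    fix v w assume vw: "v \<in> X - {r}" "w \<in> X - {r}" "{par v, v} = {par w, w}"
    show "v = w"
    proof (rule ccontr)
      assume "v \<noteq> w"
      then have "par v = w" "par w = v" using vw(3) by (auto simp: doubleton_eq_iff)
      then show False using par[OF vw(1)] par[OF vw(2)] by simp
    qed
  qed
  have sub: "(\<lambda>v. {par v, v}) ` (X - {r}) \<subseteq> F" using par by auto
  have "card (X - {r}) \<le> card F" by (rule card_inj_on_le[OF inj sub fin])
  moreover have "card X \<le> card (X - {r}) + 1"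
    by (cases "r \<in> X") (auto simp: card_Diff_singleton_if)
  ultimately show ?thesis by linarith
qed

subsection \<open>Two-page book embeddings\<close>

text \<open>At abscissa x the height is s * (x - a) * (b - x), so the sign of \<open>s\<close>
  selects the page and nested intervals give nested arcs.\<close>

definition parabola :: "real \<Rightarrow> real \<Rightarrow> real \<Rightarrow> real \<Rightarrow> complex" where
  "parabola s a b t = Complex (a + (b - a) * t) (s * ((b - a) * t) * ((b - a) * (1 - t)))"

lemma arc_parabola:
  assumes "a < b"
  shows "arc (parabola s a b)" "pathstart (parabola s a b) = of_real a"
    "pathfinish (parabola s a b) = of_real b"
proof -
  have "continuous_on {0..1} (parabola s a b)"
    unfolding parabola_def Complex_eq by (intro continuous_intros)
  moreover have "inj_on (parabola s a b) {0..1}"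
    using assms by (auto simp: inj_on_def parabola_def)
  ultimately show "arc (parabola s a b)" by (simp add: arc_def path_def)
qed (auto simp: pathstart_def pathfinish_def parabola_def complex_eq_iff)

lemma path_image_parabola:
  assumes "a < b" "z \<in> path_image (parabola s a b)"
  shows "a \<le> Re z" "Re z \<le> b" "Im z = s * ((Re z - a) * (b - Re z))"
proof -
  obtain t where t: "0 \<le> t" "t \<le> 1" "z = parabola s a b t"
    using assms(2) by (auto simp: path_image_def)
  have "(b - a) * t \<le> (b - a) * 1" using assms(1) t by (intro mult_left_mono) auto
  then have "(b - a) * t \<le> b - a" by simp
  moreover have "0 \<le> (b - a) * t" using assms t by simp
  moreover have "Re z = a + (b - a) * t" using t by (simp add: parabola_def)
  ultimately show "a \<le> Re z" "Re z \<le> b" by linarith+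
  show "Im z = s * ((Re z - a) * (b - Re z))"
    using t by (simp add: parabola_def algebra_simps)
qed

text \<open>Intervals that share a point and do not interleave are nested. The height is the product
  of the distances to the two ends, so at a common inner point strict nesting makes one height
  strictly smaller.\<close>

lemma noncrossing_parabolas:
  fixes a b c d x :: real
  assumes "a \<le> x" "x \<le> b" "c \<le> x" "x \<le> d" "a < b" "c < d"
    and eq: "(x - a) * (b - x) = (x - c) * (d - x)"
    and nc: "\<not> (a < c \<and> c < b \<and> b < d)" "\<not> (c < a \<and> a < d \<and> d < b)"
  shows "(x = a \<or> x = b) \<and> (x = c \<or> x = d) \<or> a = c \<and> b = d"
proof (cases "(x - a) * (b - x) = 0")
  case True
  then show ?thesis using eq by auto
next
  case False
  then have "x \<noteq> a" "x \<noteq> b" "x \<noteq> c" "x \<noteq> d" using eq by auto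
  then have *: "a < x" "x < b" "c < x" "x < d" using assms(1-4) by auto
  have "\<not> (a < c \<and> d \<le> b)"
  proof
    assume "a < c \<and> d \<le> b"
    then have "(x - c) * (d - x) < (x - a) * (b - x)"
      using * by (intro mult_less_le_imp_less) auto
    then show False using eq by simp
  qed
  moreover have "\<not> (c < a \<and> b \<le> d)"
  proof
    assume "c < a \<and> b \<le> d"
    then have "(x - a) * (b - x) < (x - c) * (d - x)"
      using * by (intro mult_less_le_imp_less) auto
    then show False using eq by simp
  qed
  ultimately have "a = c" using nc * by force
  then show ?thesis using eq * by auto
qed

text \<open>Vertices lie on the real axis and edges are parabolas above or below it. Arcs on one
  page are handled by \<open>noncrossing_parabolas\<close>; on different pages the heights have
  opposite signs, so arcs meet only on the axis, at ends of both.\<close>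

lemma planar_graph_two_page_real:
  fixes pos :: "'v \<Rightarrow> real" and page :: "'v set \<Rightarrow> bool"
  assumes inj: "inj_on pos V" and E: "\<And>e. e \<in> E \<Longrightarrow> e \<subseteq> V \<and> card e = 2"
    and nc: "\<And>a b c d. {a, b} \<in> E \<Longrightarrow> {c, d} \<in> E \<Longrightarrow> page {a, b} = page {c, d} \<Longrightarrow>
      pos a < pos c \<Longrightarrow> pos c < pos b \<Longrightarrow> pos b < pos d \<Longrightarrow> False"
  shows "planar_graph V E"
proof -
  have "\<exists>a b. e = {a, b} \<and> pos a < pos b" if e: "e \<in> E" for e
  proof -
    obtain a b where ab: "e = {a, b}" "a \<noteq> b" using E[OF e] by (auto simp: card_2_iff)
    then have "pos a \<noteq> pos b" using inj E[OF e] by (auto simp: inj_on_def)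
    then have "pos a < pos b \<or> pos b < pos a" by linarith
    then show ?thesis
    proof
      assume "pos b < pos a" then show ?thesis using ab(1) by (intro exI[of _ b] exI[of _ a]) auto
    qed (use ab in auto)
  qed
  then obtain l h where lh: "\<And>e. e \<in> E \<Longrightarrow> e = {l e, h e} \<and> pos (l e) < pos (h e)"
    by metis
  define s where "s e = (if page e then 1 else - 1 :: real)" for e
  define p where "p v = complex_of_real (pos v)" for v
  define \<gamma> where "\<gamma> e = parabola (s e) (pos (l e)) (pos (h e))" for e
  have ends: "pos (l e) \<le> Re z" "Re z \<le> pos (h e)"
    "Im z = s e * ((Re z - pos (l e)) * (pos (h e) - Re z))"
    if "e \<in> E" "z \<in> path_image (\<gamma> e)" for e z
    using path_image_parabola[OF _ that(2)[unfolded \<gamma>_def]] lh[OF that(1)] by auto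
  have V: "l e \<in> V" "h e \<in> V" if "e \<in> E" for e using lh[OF that] E[OF that] by blast+
  have "inj_on p V" using inj by (auto simp: inj_on_def p_def)
  moreover have "arc (\<gamma> e) \<and> {pathstart (\<gamma> e), pathfinish (\<gamma> e)} = p ` e" if "e \<in> E" for e
  proof -
    have "p ` e = p ` {l e, h e}" using lh[OF that] by simp
    then have "p ` e = {p (l e), p (h e)}" by simp
    then show ?thesis using arc_parabola[of "pos (l e)" "pos (h e)" "s e"] lh[OF that]
      by (simp add: \<gamma>_def p_def)
  qed
  moreover have "v \<in> e" if e: "e \<in> E" and v: "v \<in> V" and im: "p v \<in> path_image (\<gamma> e)" for e v
  proof -
    have "pos v = pos (l e) \<or> pos v = pos (h e)"
      using ends(3)[OF e im] by (auto simp: p_def s_def split: if_splits)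
    then have "v = l e \<or> v = h e" using inj v V[OF e] by (auto simp: inj_on_def)
    then show ?thesis using lh[OF e] by blast
  qed
  moreover have "path_image (\<gamma> e) \<inter> path_image (\<gamma> e') \<subseteq> p ` (e \<inter> e')"
    if e: "e \<in> E" "e' \<in> E" "e \<noteq> e'" for e e'
  proof
    fix z assume z: "z \<in> path_image (\<gamma> e) \<inter> path_image (\<gamma> e')"
    let ?x = "Re z"
    note e1 = ends[OF e(1), of z] and e2 = ends[OF e(2), of z]
    have both: "(?x = pos (l e) \<or> ?x = pos (h e)) \<and> (?x = pos (l e') \<or> ?x = pos (h e'))"
    proof (cases "page e = page e'")
      case True
      then have "(?x - pos (l e)) * (pos (h e) - ?x) = (?x - pos (l e')) * (pos (h e') - ?x)"
        using e1(3) e2(3) z by (auto simp: s_def split: if_splits)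
      moreover have "\<not> (pos (l e) < pos (l e') \<and> pos (l e') < pos (h e) \<and> pos (h e) < pos (h e'))"
        using nc[of "l e" "h e" "l e'" "h e'"] lh[OF e(1)] lh[OF e(2)] e True by auto
      moreover have "\<not> (pos (l e') < pos (l e) \<and> pos (l e) < pos (h e') \<and> pos (h e') < pos (h e))"
        using nc[of "l e'" "h e'" "l e" "h e"] lh[OF e(1)] lh[OF e(2)] e True by auto
      ultimately have "(?x = pos (l e) \<or> ?x = pos (h e)) \<and> (?x = pos (l e') \<or> ?x = pos (h e'))
          \<or> pos (l e) = pos (l e') \<and> pos (h e) = pos (h e')"
        using e1 e2 z lh[OF e(1)] lh[OF e(2)] by (intro noncrossing_parabolas) auto
      moreover have "\<not> (pos (l e) = pos (l e') \<and> pos (h e) = pos (h e'))"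
      proof
        assume "pos (l e) = pos (l e') \<and> pos (h e) = pos (h e')"
        then have "l e = l e'" "h e = h e'" using inj V e by (auto simp: inj_on_def)
        then show False using lh[OF e(1)] lh[OF e(2)] e(3) by metis
      qed
      ultimately show ?thesis by blast
    next
      case False
      let ?A = "(?x - pos (l e)) * (pos (h e) - ?x)" and ?B = "(?x - pos (l e')) * (pos (h e') - ?x)"
      have "0 \<le> ?A" "0 \<le> ?B" using e1 e2 z by auto
      moreover have "?A = - ?B" using False e1(3) e2(3) z by (auto simp: s_def split: if_splits)
      ultimately have "?A = 0" "?B = 0" by linarith+
      then show ?thesis by auto
    qed
    obtain v where v: "v \<in> e" "v \<in> V" "?x = pos v" using both lh[OF e(1)] V[OF e(1)] by blast
    obtain v' where v': "v' \<in> e'" "v' \<in> V" "?x = pos v'" using both lh[OF e(2)] V[OF e(2)] by blast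
    have "v = v'" using v v' inj by (auto simp: inj_on_def)
    moreover have "Im z = 0" using e1(3) z both by auto
    then have "z = p v" using v by (simp add: p_def complex_eq_iff)
    ultimately show "z \<in> p ` (e \<inter> e')" using v v' by blast
  qed
  ultimately show ?thesis unfolding planar_graph_def by blast
qed

lemma planar_graph_two_page:
  fixes page :: "'v :: linorder set \<Rightarrow> bool"
  assumes "ugraph V E"
    and nc: "\<And>a b c d. {a, b} \<in> E \<Longrightarrow> {c, d} \<in> E \<Longrightarrow> page {a, b} = page {c, d} \<Longrightarrow>
      a < c \<Longrightarrow> c < b \<Longrightarrow> b < d \<Longrightarrow> False"
  shows "planar_graph V E"
proof -
  \<comment> \<open>The rank within the finite set \<open>V\<close> turns the linear order into
    positions on the real axis.\<close>
  define pos where "pos v = real (card {u \<in> V. u < v})" for v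
  have fin: "finite V" and E: "\<And>e. e \<in> E \<Longrightarrow> e \<subseteq> V \<and> card e = 2"
    using assms(1) by (auto simp: ugraph_def)
  have mono: "pos u < pos v" if "u \<in> V" "u < v" for u v
  proof -
    have "{w \<in> V. w < u} \<subset> {w \<in> V. w < v}" using that by auto
    then show ?thesis unfolding pos_def using fin by (simp add: psubset_card_mono)
  qed
  have iff: "pos u < pos v \<longleftrightarrow> u < v" if "u \<in> V" "v \<in> V" for u v
    using mono that by (metis less_asym linorder_neqE)
  have inj: "inj_on pos V"
    using iff by (metis inj_onI less_irrefl linorder_neqE)
  show ?thesis
  proof (rule planar_graph_two_page_real[of pos V E page, OF inj E])
    fix a b c d assume *: "{a, b} \<in> E" "{c, d} \<in> E" "page {a, b} = page {c, d}"
      "pos a < pos c" "pos c < pos b" "pos b < pos d"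
    then have "a \<in> V" "b \<in> V" "c \<in> V" "d \<in> V" using E by blast+
    then show False using nc[of a b c d] * by (simp add: iff)
  qed auto
qed

subsection \<open>Renaming vertices\<close>

text \<open>The construction has lists as vertices while the theorem speaks of vertices in
  \<open>nat\<close>; an injective renaming bridges the two, with \<open>inv f\<close> recovering
  the original edge.\<close>

definition relabel :: "('a \<Rightarrow> 'b) \<Rightarrow> 'a pcsf \<Rightarrow> 'b pcsf" where
  "relabel f J = \<lparr>verts = f ` verts J, edges = (`) f ` edges J, cost = (\<lambda>e. cost J (inv f ` e)),
     npairs = npairs J, src = f \<circ> src J, tgt = f \<circ> tgt J, penalty = penalty J\<rparr>"

context
  fixes f :: "'a \<Rightarrow> 'b" and J :: "'a pcsf"
  assumes inj: "inj f"
begin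

lemma inv_image [simp]: "inv f ` f ` e = e"
  using inj by (simp add: image_comp)

lemma inj_image: "inj_on ((`) f) A"
  by (rule inj_on_inverseI[of _ "(`) (inv f)"]) simp

lemma pcsf_instance_relabel: "pcsf_instance J \<Longrightarrow> pcsf_instance (relabel f J)"
  using inj by (auto simp: pcsf_instance_def ugraph_def relabel_def card_image inj_on_subset)

lemma planar_graph_relabel:
  assumes "planar_graph (verts J) (edges J)"
  shows "planar_graph (verts (relabel f J)) (edges (relabel f J))"
  using assms unfolding planar_graph_def
proof (elim exE conjE)
  fix p :: "'a \<Rightarrow> complex" and \<gamma> :: "'a set \<Rightarrow> real \<Rightarrow> complex"
  assume "inj_on p (verts J)"
  then have "inj_on (\<lambda>v. p (inv f v)) (f ` verts J)"
    using inj by (auto simp: inj_on_def)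
  moreover assume "\<forall>e\<in>edges J. arc (\<gamma> e) \<and> {pathstart (\<gamma> e), pathfinish (\<gamma> e)} = p ` e"
    and "\<forall>e\<in>edges J. \<forall>v\<in>verts J. p v \<in> path_image (\<gamma> e) \<longrightarrow> v \<in> e"
    and "\<forall>e\<in>edges J. \<forall>e'\<in>edges J. e \<noteq> e' \<longrightarrow>
      path_image (\<gamma> e) \<inter> path_image (\<gamma> e') \<subseteq> p ` (e \<inter> e')"
  moreover have "(\<lambda>x. p (inv f x)) ` (f ` e \<inter> f ` e') = p ` (e \<inter> e')" for e e'
    using inj by (simp add: image_Int[symmetric] image_image)
  ultimately show "\<exists>(p :: 'b \<Rightarrow> complex) \<gamma>. inj_on p (verts (relabel f J)) \<and>
     (\<forall>e\<in>edges (relabel f J). arc (\<gamma> e) \<and> {pathstart (\<gamma> e), pathfinish (\<gamma> e)} = p ` e) \<and>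
     (\<forall>e\<in>edges (relabel f J). \<forall>v\<in>verts (relabel f J). p v \<in> path_image (\<gamma> e) \<longrightarrow> v \<in> e) \<and>
     (\<forall>e\<in>edges (relabel f J). \<forall>e'\<in>edges (relabel f J). e \<noteq> e' \<longrightarrow>
        path_image (\<gamma> e) \<inter> path_image (\<gamma> e') \<subseteq> p ` (e \<inter> e'))"
    unfolding relabel_def pcsf.simps ball_simps inv_image
    using inj by (intro exI[of _ "\<lambda>v. p (inv f v)"] exI[of _ "\<lambda>e. \<gamma> (inv f ` e)"])
      (simp add: image_image inj_image_mem_iff inj_image_eq_iff)
qed

lemma cut_relabel: "cut (relabel f J) S = (`) f ` cut J (f -` S)"
proof -
  have "card (f ` e \<inter> S) = card (e \<inter> f -` S)" for e
  proof -
    have "f ` e \<inter> S = f ` (e \<inter> f -` S)" by auto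
    then show ?thesis using inj by (simp add: card_image inj_on_subset)
  qed
  then show ?thesis by (auto simp: cut_def relabel_def)
qed

lemma lp_relabel:
  assumes "lp_feasible J x z"
  shows "lp_feasible (relabel f J) (\<lambda>e. x (inv f ` e)) z"
    "(\<Sum>e\<in>edges (relabel f J). cost (relabel f J) e * x (inv f ` e)) =
     (\<Sum>e\<in>edges J. cost J e * x e)"
proof -
  have "1 \<le> (\<Sum>e\<in>cut (relabel f J) S. x (inv f ` e)) + z i"
    if "S \<subseteq> verts (relabel f J)" "i < npairs (relabel f J)" "separates (relabel f J) i S" for S i
  proof -
    have "f -` S \<subseteq> verts J" "i < npairs J" "separates J i (f -` S)"
      using that inj by (auto simp: relabel_def separates_def dest: injD)
    then have "1 \<le> (\<Sum>e\<in>cut J (f -` S). x e) + z i" using assms by (auto simp: lp_feasible_def)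
    then show ?thesis by (simp add: cut_relabel sum.reindex[OF inj_image])
  qed
  then show "lp_feasible (relabel f J) (\<lambda>e. x (inv f ` e)) z"
    using assms by (auto simp: lp_feasible_def relabel_def)
  show "(\<Sum>e\<in>edges (relabel f J). cost (relabel f J) e * x (inv f ` e)) =
     (\<Sum>e\<in>edges J. cost J e * x e)"
    by (simp add: relabel_def sum.reindex[OF inj_image])
qed

lemma forest_relabel:
  assumes "F' \<subseteq> edges (relabel f J)"
  obtains F where "F \<subseteq> edges J" "forest_cost (relabel f J) F' = forest_cost J F"
    "forest_penalty (relabel f J) F' = forest_penalty J F"
proof -
  obtain F where F: "F \<subseteq> edges J" "F' = (`) f ` F"
    using assms by (auto simp: relabel_def subset_image_iff)
  have 1: "linked F' (f u) (f v)" if "linked F u v" for u v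
    using that
  proof (rule linked_map)
    fix a b assume "{a, b} \<in> F"
    then have "f ` {a, b} \<in> F'" using F(2) by blast
    then show "f a = f b \<or> {f a, f b} \<in> F'" by simp
  qed
  have 2: "linked F u v" if "linked F' (f u) (f v)" for u v
  proof -
    have "linked F (inv f (f u)) (inv f (f v))"
      using that
    proof (rule linked_map)
      fix a b assume "{a, b} \<in> F'"
      then obtain e where "e \<in> F" "{a, b} = f ` e" using F(2) by auto
      moreover have "inv f ` {a, b} = {inv f a, inv f b}" by simp
      ultimately show "inv f a = inv f b \<or> {inv f a, inv f b} \<in> F" by (metis inv_image)
    qed
    then show ?thesis using inj by simp
  qed
  have "linked F' (f u) (f v) \<longleftrightarrow> linked F u v" for u v using 1 2 by blast
  then have "forest_penalty (relabel f J) F' = forest_penalty J F"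
    by (simp add: forest_penalty_def relabel_def)
  moreover have "forest_cost (relabel f J) F' = forest_cost J F"
    by (simp add: forest_cost_def relabel_def F(2) sum.reindex[OF inj_image])
  ultimately show thesis using that F(1) by blast
qed

end

subsection \<open>Bounds on the two optima\<close>

lemma opt_LP_le:
  assumes "pcsf_instance J" "lp_feasible J x z"
  shows "opt_LP J \<le> lp_value J x z"
  unfolding opt_LP_def using assms by (intro cInf_lower lp_values_bdd_below) auto

lemma opt_IP_ge:
  assumes "pcsf_instance J"
    and "\<And>F. F \<subseteq> edges J \<Longrightarrow> B \<le> forest_cost J F + forest_penalty J F"
  shows "B \<le> opt_IP J"
  unfolding opt_IP_def
proof (subst Min_ge_iff)
  show "finite ((\<lambda>F. forest_cost J F + forest_penalty J F) ` {F. forest_in (edges J) F})"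
    using finite_forests[OF assms(1)] by simp
qed (use assms(2) forest_in_empty in \<open>auto simp: forest_in_def\<close>)

text \<open>The cut around the single node \<open>src J i\<close> forces every feasible solution to
  spend one unit on its edges and on \<open>z i\<close>, and a unit costs at least the smallest of
  the edge costs and \<open>penalty J i\<close>.\<close>

lemma opt_LP_pos:
  assumes J: "pcsf_instance J" and c: "\<And>e. e \<in> edges J \<Longrightarrow> 0 < cost J e"
    and i: "i < npairs J" "0 < penalty J i" "src J i \<noteq> tgt J i"
  shows "0 < opt_LP J"
proof -
  have "edges J \<subseteq> Pow (verts J)" "finite (verts J)"
    using J by (auto simp: pcsf_instance_def ugraph_def)
  then have fin: "finite (edges J)" using finite_subset by blast
  define \<mu> where "\<mu> = Min (insert (penalty J i) (cost J ` edges J))"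
  have \<mu>: "0 < \<mu>" "\<mu> \<le> penalty J i" "\<And>e. e \<in> edges J \<Longrightarrow> \<mu> \<le> cost J e"
    using fin c i by (auto simp: \<mu>_def)
  have "\<mu> \<le> lp_value J x z" if f: "lp_feasible J x z" for x z
  proof -
    let ?C = "cut J {src J i}"
    have C: "?C \<subseteq> edges J" by (auto simp: cut_def)
    have x: "\<And>e. e \<in> edges J \<Longrightarrow> 0 \<le> x e" and z: "\<And>j. j < npairs J \<Longrightarrow> 0 \<le> z j"
      using f by (auto simp: lp_feasible_def)
    have "separates J i {src J i}" using i(3) by (auto simp: separates_def)
    moreover have "{src J i} \<subseteq> verts J" using J i(1) by (auto simp: pcsf_instance_def)
    ultimately have "1 \<le> (\<Sum>e\<in>?C. x e) + z i" using f i(1) by (auto simp: lp_feasible_def)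
    then have "\<mu> * 1 \<le> \<mu> * ((\<Sum>e\<in>?C. x e) + z i)" using \<mu>(1) by (intro mult_left_mono) auto
    also have "\<dots> = (\<Sum>e\<in>?C. \<mu> * x e) + \<mu> * z i" by (simp add: distrib_left sum_distrib_left)
    also have "(\<Sum>e\<in>?C. \<mu> * x e) \<le> (\<Sum>e\<in>?C. cost J e * x e)"
      using C \<mu>(3) x by (intro sum_mono mult_right_mono) auto
    also have "\<dots> \<le> (\<Sum>e\<in>edges J. cost J e * x e)"
      using C fin c x by (intro sum_mono2) (auto simp: less_imp_le)
    also have "\<mu> * z i \<le> penalty J i * z i" using \<mu>(2) z i by (intro mult_right_mono) auto
    also have "\<dots> \<le> (\<Sum>j<npairs J. penalty J j * z j)"
      using i(1) J z by (intro member_le_sum) (auto simp: pcsf_instance_def)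
    finally show ?thesis by (simp add: lp_value_def)
  qed
  then have "\<mu> \<le> opt_LP J"
    unfolding opt_LP_def by (intro cInf_greatest lp_values_nonempty[OF J]) auto
  then show ?thesis using \<mu>(1) by simp
qed

subsection \<open>Subdivided multigraphs\<close>

lemma card_doubleton_Int_eq_1:
  "a \<noteq> b \<Longrightarrow> card ({a, b} \<inter> S) = 1 \<longleftrightarrow> (a \<in> S) \<noteq> (b \<in> S)"
  by (cases "a \<in> S"; cases "b \<in> S") (auto simp: Int_insert_left)

text \<open>A discrete intermediate value principle, used to find cut edges along paths and
  cycles.\<close>

lemma ex_change_between:
  fixes P :: "nat \<Rightarrow> bool"
  assumes "a \<le> b" "P a \<noteq> P b"
  shows "\<exists>i. a \<le> i \<and> i < b \<and> P i \<noteq> P (Suc i)"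
  using assms
proof (induction rule: dec_induct)
  case base then show ?case by simp
next
  case (step j)
  then show ?case
    by (cases "P a = P j") (auto intro: less_SucI)
qed

text \<open>A multigraph on \<open>{..<n}\<close>. An edge \<open>e\<close> joins \<open>fst e\<close> and \<open>hi e\<close>; its second component only
  tells edges with the same lower end apart. Each edge is subdivided by \<open>k\<close> inner nodes; the
  original vertex \<open>v\<close> becomes \<open>[v]\<close>, and the \<open>i\<close>-th inner node of \<open>(u, b)\<close> becomes \<open>[u, b, i]\<close>.\<close>

locale multigraph =
  fixes n :: nat and E0 :: "(nat \<times> nat) set" and hi :: "nat \<times> nat \<Rightarrow> nat" and d k :: nat
  assumes finite_E0: "finite E0" and n_ge: "2 \<le> n" and k_pos: "0 < k" and d_ge: "2 \<le> d"
    and ends: "e \<in> E0 \<Longrightarrow> fst e < hi e" "e \<in> E0 \<Longrightarrow> hi e < n"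
    and edge_connected: "x < n \<Longrightarrow> y < n \<Longrightarrow> x \<in> S \<Longrightarrow> y \<notin> S \<Longrightarrow>
      d \<le> card {e \<in> E0. (fst e \<in> S) \<noteq> (hi e \<in> S)}"
    and tree_card: "n - 1 \<le> card E0"
begin

text \<open>Indices 0 and \<open>Suc k\<close> are the two original ends, so the k + 1 edges of the
  path are uniformly the pairs of consecutive indices.\<close>

definition pnode :: "nat \<times> nat \<Rightarrow> nat \<Rightarrow> nat list" where
  "pnode e i = (if i = 0 then [fst e] else if i \<le> k then [fst e, snd e, i] else [hi e])"

definition pedge :: "nat \<times> nat \<Rightarrow> nat \<Rightarrow> nat list set" where
  "pedge e i = {pnode e i, pnode e (Suc i)}"

definition inner :: "nat list set" where
  "inner = (\<lambda>(e, i). [fst e, snd e, i]) ` (E0 \<times> {1..k})"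

definition nodes :: "nat list set" where
  "nodes = (\<lambda>v. [v]) ` {..<n} \<union> inner"

definition sedges :: "nat list set set" where
  "sedges = (\<lambda>(e, i). pedge e i) ` (E0 \<times> {..k})"

lemma E0_ne: "card E0 > 0"
  using tree_card n_ge by linarith

lemma finite_inner: "finite inner" and card_inner: "card inner = k * card E0"
proof -
  show "finite inner" by (simp add: inner_def finite_E0)
  have "inj_on (\<lambda>(e, i). [fst e, snd e, i]) (E0 \<times> {1..k})"
    by (auto simp: inj_on_def prod_eq_iff)
  then show "card inner = k * card E0"
    by (simp add: inner_def card_image card_cartesian_product)
qed

lemma finite_nodes: "finite nodes"
  by (simp add: nodes_def finite_inner)

lemma single_notin_inner: "[v] \<notin> inner"
  by (auto simp: inner_def)

lemma innerE:
  assumes "w \<in> inner"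
  obtains e i where "e \<in> E0" "1 \<le> i" "i \<le> k" "w = pnode e i"
  using assms by (auto simp: inner_def pnode_def)

lemma pnode_in_inner: "e \<in> E0 \<Longrightarrow> 1 \<le> i \<Longrightarrow> i \<le> k \<Longrightarrow> pnode e i \<in> inner"
  by (force simp: inner_def pnode_def)

lemma pnode_in_nodes: "e \<in> E0 \<Longrightarrow> pnode e i \<in> nodes"
  using ends[of e] pnode_in_inner[of e i] by (auto simp: nodes_def pnode_def)

lemma pnode_neq_Suc: "e \<in> E0 \<Longrightarrow> pnode e i \<noteq> pnode e (Suc i) \<or> k < i"
  using ends[of e] by (auto simp: pnode_def)

text \<open>Since 0 < k, every edge of a path has an inner node as an end, and that node determines
  \<open>e\<close>. Subdivision thus turns parallel edges into a simple graph.\<close>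

lemma inj_pedge: "inj_on (\<lambda>(e, i). pedge e i) (E0 \<times> {..k})"
proof (rule inj_onI)
  fix p p' assume *: "p \<in> E0 \<times> {..k}" "p' \<in> E0 \<times> {..k}"
    "(\<lambda>(e, i). pedge e i) p = (\<lambda>(e, i). pedge e i) p'"
  obtain u b i u' b' i' where p: "p = ((u, b), i)" "p' = ((u', b'), i')"
    by (metis prod.exhaust)
  then show "p = p'"
    using * ends[of "(u, b)"] ends[of "(u', b')"] k_pos
    by (auto simp: pedge_def pnode_def doubleton_eq_iff split: if_splits)
qed

lemma finite_sedges: "finite sedges" and card_sedges: "card sedges = card E0 * (k + 1)"
  using finite_E0 by (auto simp: sedges_def card_image[OF inj_pedge] card_cartesian_product)

lemma pedge_in_sedges: "e \<in> E0 \<Longrightarrow> i \<le> k \<Longrightarrow> pedge e i \<in> sedges"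
  by (auto simp: sedges_def)

lemma sedges_nodes: "g \<in> sedges \<Longrightarrow> g \<subseteq> nodes"
  by (auto simp: sedges_def pedge_def pnode_in_nodes)

lemma card_sedge:
  assumes "g \<in> sedges"
  shows "card g = 2"
proof -
  obtain e i where "e \<in> E0" "i \<le> k" "g = pedge e i" using assms by (auto simp: sedges_def)
  then show ?thesis using pnode_neq_Suc[of e i] by (simp add: pedge_def)
qed

text \<open>The inner node later serves to recognise the copy and the depth to which an edge
  belongs.\<close>

lemma sedge_inner: "g \<in> sedges \<Longrightarrow> \<exists>w \<in> g. w \<in> inner"
proof -
  assume "g \<in> sedges"
  then obtain e i where ei: "e \<in> E0" "i \<le> k" "g = pedge e i" by (auto simp: sedges_def)
  show ?thesis
  proof (cases "i = 0")
    case True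
    then have "pnode e (Suc i) \<in> inner" using ei k_pos by (intro pnode_in_inner) auto
    then show ?thesis using ei by (auto simp: pedge_def)
  next
    case False
    then have "pnode e i \<in> inner" using ei by (intro pnode_in_inner) auto
    then show ?thesis using ei by (auto simp: pedge_def)
  qed
qed

lemma card_pedge_Int:
  assumes "e \<in> E0" "i \<le> k"
  shows "card (pedge e i \<inter> S) = 1 \<longleftrightarrow> (pnode e i \<in> S) \<noteq> (pnode e (Suc i) \<in> S)"
  unfolding pedge_def using pnode_neq_Suc[OF assms(1), of i] assms(2)
  by (intro card_doubleton_Int_eq_1) auto

lemma pnode_ends: "pnode e 0 = [fst e]" "pnode e (Suc k) = [hi e]"
  by (auto simp: pnode_def)

text \<open>Along the path of each multigraph edge cut by \<open>S\<close>, membership in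
  \<open>S\<close> changes somewhere; choosing one such path edge for each is injective.\<close>

lemma cut_sedges_original:
  assumes "x < n" "y < n" "[x] \<in> S" "[y] \<notin> S"
  shows "d \<le> card {g \<in> sedges. card (g \<inter> S) = 1}"
proof -
  let ?C = "{e \<in> E0. (fst e \<in> {v. [v] \<in> S}) \<noteq> (hi e \<in> {v. [v] \<in> S})}"
  define f where "f e = (SOME i. i \<le> k \<and> (pnode e i \<in> S) \<noteq> (pnode e (Suc i) \<in> S))" for e
  have "\<exists>i. i \<le> k \<and> (pnode e i \<in> S) \<noteq> (pnode e (Suc i) \<in> S)" if "e \<in> ?C" for e
    using ex_change_between[of 0 "Suc k" "\<lambda>i. pnode e i \<in> S"] that
    unfolding less_Suc_eq_le pnode_ends by blast
  then have f: "f e \<le> k \<and> (pnode e (f e) \<in> S) \<noteq> (pnode e (Suc (f e)) \<in> S)" if "e \<in> ?C" for e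
    unfolding f_def by (rule someI_ex) (fact that)
  have "d \<le> card ?C" using edge_connected[of x y "{v. [v] \<in> S}"] assms by simp
  also have "\<dots> \<le> card {g \<in> sedges. card (g \<inter> S) = 1}"
  proof (rule card_inj_on_le)
    show "inj_on (\<lambda>e. pedge e (f e)) ?C"
    proof (rule inj_onI)
      fix e e' assume "e \<in> ?C" "e' \<in> ?C" "pedge e (f e) = pedge e' (f e')"
      then show "e = e'"
        using inj_onD[OF inj_pedge, of "(e, f e)" "(e', f e')"] f[of e] f[of e'] by auto
    qed
    show "(\<lambda>e. pedge e (f e)) ` ?C \<subseteq> {g \<in> sedges. card (g \<inter> S) = 1}"
      using f by (auto simp: pedge_in_sedges card_pedge_Int simp del: One_nat_def)
  qed (simp add: finite_sedges)
  finally show ?thesis .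
qed

text \<open>If \<open>S\<close> separates two original vertices, the previous bound suffices.
  Otherwise both ends of the path through \<open>w\<close> lie on the other side, so membership
  changes once before \<open>w\<close> and once after it.\<close>

lemma cut_sedges_inner:
  assumes "w \<in> inner" "([0] \<in> S) \<noteq> (w \<in> S)"
  shows "2 \<le> card {g \<in> sedges. card (g \<inter> S) = 1}"
proof (cases "\<exists>x y. x < n \<and> y < n \<and> [x] \<in> S \<and> [y] \<notin> S")
  case True
  then show ?thesis using cut_sedges_original d_ge by (meson order_trans)
next
  case False
  obtain e i where ei: "e \<in> E0" "1 \<le> i" "i \<le> k" "w = pnode e i"
    using innerE[OF assms(1)] by metis
  have "(\<forall>v<n. [v] \<in> S) \<or> (\<forall>v<n. [v] \<notin> S)" using False by blast
  then have "([fst e] \<in> S) \<noteq> (w \<in> S)" "([hi e] \<in> S) \<noteq> (w \<in> S)"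
    using assms(2) ends[OF ei(1)] n_ge by auto
  then have "(pnode e 0 \<in> S) \<noteq> (pnode e i \<in> S)" "(pnode e i \<in> S) \<noteq> (pnode e (Suc k) \<in> S)"
    unfolding pnode_ends ei(4) by auto
  then obtain i1 i2 where i1: "i1 < i" "(pnode e i1 \<in> S) \<noteq> (pnode e (Suc i1) \<in> S)"
    and i2: "i \<le> i2" "i2 \<le> k" "(pnode e i2 \<in> S) \<noteq> (pnode e (Suc i2) \<in> S)"
    using ex_change_between[of 0 i "\<lambda>i. pnode e i \<in> S"]
      ex_change_between[of i "Suc k" "\<lambda>i. pnode e i \<in> S"] ei(3)
    unfolding less_Suc_eq_le by (metis le0 le_SucI)
  have "pedge e i1 \<noteq> pedge e i2"
    using inj_onD[OF inj_pedge, of "(e, i1)" "(e, i2)"] ei i1 i2 by auto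
  then have "2 = card {pedge e i1, pedge e i2}" by simp
  also have "\<dots> \<le> card {g \<in> sedges. card (g \<inter> S) = 1}"
    using ei i1 i2 finite_sedges
    by (intro card_mono) (auto simp: pedge_in_sedges card_pedge_Int simp del: One_nat_def)
  finally show ?thesis .
qed

text \<open>Only completely bought paths help to connect original vertices. Contracting the partial
  ones leaves a connected multigraph, so at least n - 1 paths are complete, with k + 1 edges
  each.\<close>

lemma card_spanning_sedges:
  assumes A: "A \<subseteq> sedges" and conn: "\<And>v. v < n \<Longrightarrow> linked A [0] [v]"
  shows "(n - 1) * (k + 1) \<le> card A"
proof -
  define B where "B = {e \<in> E0. \<forall>i\<le>k. pedge e i \<in> A}"
  \<comment> \<open>An inner node goes to the lower end of its path as long as all earlier edges of
    the path are in \<open>A\<close>, and to the upper end after the first gap. An edge of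
    \<open>A\<close> then has ends with different images only if it is the last one of a complete
    path.\<close>
  define \<phi> where "\<phi> g = (if length g = 1 then g ! 0 else
    if \<forall>j<g ! 2. pedge (g ! 0, g ! 1) j \<in> A then g ! 0 else hi (g ! 0, g ! 1))" for g
  have \<phi>: "\<phi> (pnode e i) = (if i \<le> k \<and> (\<forall>j<i. pedge e j \<in> A) then fst e else hi e)"
    if "e \<in> E0" for e i
    by (auto simp: \<phi>_def pnode_def)
  have fB: "finite B" by (simp add: B_def finite_E0)
  have step: "\<phi> (pnode e i) = \<phi> (pnode e (Suc i)) \<or>
      (\<phi> (pnode e i) = fst e \<and> \<phi> (pnode e (Suc i)) = hi e \<and> e \<in> B)"
    if "e \<in> E0" "i \<le> k" "pedge e i \<in> A" for e i
  proof (cases "i = k")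
    case True
    then show ?thesis using that by (auto simp: \<phi> B_def le_less)
  next
    case False
    then have "Suc i \<le> k" using that by simp
    then show ?thesis using that by (auto simp: \<phi> less_Suc_eq)
  qed
  have "linked ((\<lambda>e. {fst e, hi e}) ` B) (\<phi> [0]) (\<phi> [v])" if "v < n" for v
    using conn[OF that]
  proof (rule linked_map)
    fix a b assume ab: "{a, b} \<in> A"
    then obtain e i where ei: "e \<in> E0" "i \<le> k" "{a, b} = pedge e i"
      using A by (auto simp: sedges_def)
    then have "{\<phi> a, \<phi> b} = {\<phi> (pnode e i), \<phi> (pnode e (Suc i))}"
      unfolding pedge_def by (metis image_empty image_insert)
    then show "\<phi> a = \<phi> b \<or> {\<phi> a, \<phi> b} \<in> (\<lambda>e. {fst e, hi e}) ` B"
      using step[OF ei(1,2)] ab ei(3) by (auto simp: doubleton_eq_iff)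
  qed
  then have "card {..<n} \<le> card ((\<lambda>e. {fst e, hi e}) ` B) + 1"
    using fB by (intro card_linked_le[of _ _ 0]) (auto simp: \<phi>_def)
  then have "n - 1 \<le> card B" using card_image_le[OF fB, of "\<lambda>e. {fst e, hi e}"] by simp
  then have "(n - 1) * (k + 1) \<le> card B * (k + 1)" by (rule mult_le_mono1)
  also have "\<dots> = card (B \<times> {..k})" by (simp add: card_cartesian_product)
  also have "\<dots> \<le> card A"
  proof (rule card_inj_on_le)
    show "inj_on (\<lambda>(e, i). pedge e i) (B \<times> {..k})"
      by (rule inj_on_subset[OF inj_pedge]) (auto simp: B_def)
    show "(\<lambda>(e, i). pedge e i) ` (B \<times> {..k}) \<subseteq> A" by (auto simp: B_def)
    show "finite A" using A finite_sedges by (rule finite_subset)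
  qed
  finally show ?thesis .
qed

text \<open>For a copy whose root is connected to the global root: there, every inner node that is
  reached counts as one more vertex of the connected set.\<close>

lemma card_spanning_sedges_inner:
  assumes A: "A \<subseteq> sedges" and conn: "\<And>v. v < n \<Longrightarrow> linked A [0] [v]"
    and W: "W \<subseteq> inner" "\<And>w. w \<in> W \<Longrightarrow> linked A [0] w"
  shows "n - 1 + card W \<le> card A"
proof -
  have "finite A" using A finite_sedges by (rule finite_subset)
  then have "card ((\<lambda>v. [v]) ` {..<n} \<union> W) \<le> card A + 1"
    by (rule card_linked_le[of _ _ "[0]"]) (use conn W in auto)
  moreover have "finite W" using W(1) finite_inner by (rule finite_subset)
  then have "card ((\<lambda>v. [v]) ` {..<n} \<union> W) = n + card W"
    using W(1) single_notin_inner by (subst card_Un_disjoint) (auto simp: card_image inj_on_def)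
  ultimately show ?thesis using n_ge by linarith
qed

end

subsection \<open>A tree of copies\<close>

text \<open>A vertex of the tree is a list of nodes of the subdivided multigraph. The copy at address
  \<open>xs\<close>, a list of inner nodes, has its root \<open>[0]\<close> at \<open>xs\<close> and every other node \<open>g\<close> at \<open>xs @ [g]\<close>, so
  that each inner node of a copy is the root of a copy one level deeper.\<close>

locale copy_tree = multigraph +
  fixes m :: nat
  assumes m_pos: "0 < m"
begin

definition place :: "nat list list \<Rightarrow> nat list \<Rightarrow> nat list list" where
  "place xs g = (if g = [0] then xs else xs @ [g])"

definition level :: "nat \<Rightarrow> nat list list set" where
  "level j = {xs. set xs \<subseteq> inner \<and> length xs = j}"

definition addresses :: "nat list list set" where
  "addresses = (\<Union>j<m. level j)"

definition copy :: "nat list list \<Rightarrow> nat list list set set" where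
  "copy xs = (\<lambda>g. place xs ` g) ` sedges"

definition tree_verts :: "nat list list set" where
  "tree_verts = (\<Union>xs\<in>addresses. place xs ` nodes)"

definition tree_edges :: "nat list list set set" where
  "tree_edges = (\<Union>xs\<in>addresses. copy xs)"

definition targets :: "nat list list set" where
  "targets = (\<Union>xs\<in>addresses. (\<lambda>g. xs @ [g]) ` (nodes - {[0]}))"

lemma inj_place: "inj (place xs)"
  by (auto simp: inj_on_def place_def)

lemma finite_level: "finite (level j)" and card_level: "card (level j) = card inner ^ j"
  unfolding level_def using finite_inner by (auto simp: finite_lists_length_eq card_lists_length_eq)

lemma finite_addresses: "finite addresses"
  by (simp add: addresses_def finite_level)

lemma Nil_address: "[] \<in> addresses"
  using m_pos by (auto simp: addresses_def level_def)

lemma addresses_iff: "xs \<in> addresses \<longleftrightarrow> set xs \<subseteq> inner \<and> length xs < m"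
  by (auto simp: addresses_def level_def)

lemma finite_targets: "finite targets"
  by (simp add: targets_def finite_addresses finite_nodes)

lemma single_in_nodes: "v < n \<Longrightarrow> [v] \<in> nodes"
  by (auto simp: nodes_def)

lemma place_in_verts: "xs \<in> addresses \<Longrightarrow> g \<in> nodes \<Longrightarrow> place xs g \<in> tree_verts"
  by (auto simp: tree_verts_def)

lemma address_in_verts: "xs \<in> addresses \<Longrightarrow> xs \<in> tree_verts"
  using place_in_verts[of xs "[0]"] single_in_nodes[of 0] n_ge by (simp add: place_def)

lemma targets_in_verts: "targets \<subseteq> tree_verts"
proof
  fix t assume "t \<in> targets"
  then obtain xs g where "xs \<in> addresses" "g \<in> nodes" "g \<noteq> [0]" "t = xs @ [g]"
    by (auto simp: targets_def)
  then show "t \<in> tree_verts" using place_in_verts[of xs g] by (simp add: place_def)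
qed

lemma ugraph_tree: "ugraph tree_verts tree_edges"
  unfolding ugraph_def
proof (intro conjI ballI)
  show "finite tree_verts" by (simp add: tree_verts_def finite_addresses finite_nodes)
  fix e assume "e \<in> tree_edges"
  then obtain xs g where "xs \<in> addresses" "g \<in> sedges" "e = place xs ` g"
    by (auto simp: tree_edges_def copy_def)
  then show "e \<subseteq> tree_verts" "card e = 2"
    using sedges_nodes[of g] card_sedge[of g] inj_place[of xs]
    by (auto simp: place_in_verts card_image inj_on_subset)
qed

lemma finite_copy: "finite (copy xs)"
  and card_copy_Int: "card (F \<inter> copy xs) = card {g \<in> sedges. place xs ` g \<in> F}"
proof -
  show "finite (copy xs)" by (simp add: copy_def finite_sedges)
  have "F \<inter> copy xs = (\<lambda>g. place xs ` g) ` {g \<in> sedges. place xs ` g \<in> F}" by (auto simp: copy_def)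
  moreover have "inj_on (\<lambda>g. place xs ` g) {g \<in> sedges. place xs ` g \<in> F}"
    by (rule inj_onI) (simp add: inj_image_eq_iff[OF inj_place])
  ultimately show "card (F \<inter> copy xs) = card {g \<in> sedges. place xs ` g \<in> F}" by (simp add: card_image)
qed

text \<open>An inner node \<open>w\<close> of an edge in the copy at \<open>xs\<close> is placed at
  \<open>xs @ [w]\<close>, which the copy at \<open>ys\<close> contains only if \<open>ys\<close> is
  \<open>xs\<close> or \<open>xs @ [w]\<close>. For distinct addresses each would have to be longer
  than the other.\<close>

lemma copy_disjoint:
  assumes "xs \<noteq> ys"
  shows "copy xs \<inter> copy ys = {}"
proof -
  have *: "ys = xs' @ [w] \<or> ys = xs'"
    if "g \<in> sedges" "w \<in> g" "w \<in> inner" "place xs' ` g = place ys ` h" for g h w xs' ys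
  proof -
    have "place xs' w = xs' @ [w]" using that(3) single_notin_inner by (auto simp: place_def)
    then have "xs' @ [w] \<in> place ys ` h" using that by (metis imageI)
    then show ?thesis by (auto simp: place_def split: if_splits)
  qed
  show ?thesis
  proof (rule ccontr)
    assume "copy xs \<inter> copy ys \<noteq> {}"
    then obtain g h where gh: "g \<in> sedges" "h \<in> sedges" "place xs ` g = place ys ` h"
      by (auto simp: copy_def)
    obtain v w where "v \<in> g" "v \<in> inner" "w \<in> h" "w \<in> inner" using gh sedge_inner by meson
    then have "ys = xs @ [v]" "xs = ys @ [w]"
      using *[of g v xs ys h] *[of h w ys xs g] gh assms by auto
    then show False by simp
  qed
qed

text \<open>The inner end of an edge is placed one level below the address of its copy, so the depth
  can be read off the edge itself; edge costs are defined in this way.\<close>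

lemma copy_depth:
  assumes "e \<in> copy xs"
  shows "Max (length ` e) - 1 = length xs"
proof -
  obtain g where g: "g \<in> sedges" "e = place xs ` g" using assms by (auto simp: copy_def)
  obtain w where w: "w \<in> g" "w \<in> inner" using sedge_inner[OF g(1)] by blast
  have "finite g" using card_sedge[OF g(1)] card.infinite by fastforce
  moreover have "place xs w = xs @ [w]" using w(2) single_notin_inner by (auto simp: place_def)
  then have "Suc (length xs) \<in> length ` e" using w(1) g(2) by force
  moreover have "\<And>l. l \<in> length ` e \<Longrightarrow> l \<le> Suc (length xs)" using g(2) by (auto simp: place_def)
  ultimately have "Max (length ` e) = Suc (length xs)" using g(2) by (intro Max_eqI) auto
  then show ?thesis by simp
qed

lemma sum_tree_edges:
  assumes "F \<subseteq> tree_edges"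
  shows "(\<Sum>e\<in>F. f (Max (length ` e) - 1)) = (\<Sum>j<m. f j * real (\<Sum>xs\<in>level j. card (F \<inter> copy xs)))"
proof -
  have "F = (\<Union>xs\<in>addresses. F \<inter> copy xs)" using assms by (auto simp: tree_edges_def)
  then have "(\<Sum>e\<in>F. f (Max (length ` e) - 1)) =
      (\<Sum>e\<in>(\<Union>xs\<in>addresses. F \<inter> copy xs). f (Max (length ` e) - 1))"
    by simp
  also have "\<dots> = (\<Sum>xs\<in>addresses. \<Sum>e\<in>F \<inter> copy xs. f (Max (length ` e) - 1))"
    by (rule sum.UNION_disjoint) (use finite_addresses finite_copy copy_disjoint in auto)
  also have "\<dots> = (\<Sum>xs\<in>addresses. f (length xs) * real (card (F \<inter> copy xs)))"
  proof (rule sum.cong)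
    fix xs
    have "(\<Sum>e\<in>F \<inter> copy xs. f (Max (length ` e) - 1)) = (\<Sum>e\<in>F \<inter> copy xs. f (length xs))"
      by (rule sum.cong) (auto simp: copy_depth[of _ xs] simp del: One_nat_def)
    then show "(\<Sum>e\<in>F \<inter> copy xs. f (Max (length ` e) - 1)) = f (length xs) * real (card (F \<inter> copy xs))"
      by (simp add: mult.commute)
  qed simp
  also have "\<dots> = (\<Sum>j<m. \<Sum>xs\<in>level j. f (length xs) * real (card (F \<inter> copy xs)))"
    unfolding addresses_def
    by (rule sum.UNION_disjoint) (use finite_level in \<open>auto simp: level_def\<close>)
  also have "\<dots> = (\<Sum>j<m. \<Sum>xs\<in>level j. f j * real (card (F \<inter> copy xs)))"
    by (intro sum.cong) (auto simp: level_def)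
  finally show ?thesis by (simp add: sum_distrib_left)
qed

lemma level_Suc: "level (Suc j) = (\<lambda>(xs, w). xs @ [w]) ` (level j \<times> inner)"
proof
  show "level (Suc j) \<subseteq> (\<lambda>(xs, w). xs @ [w]) ` (level j \<times> inner)"
  proof
    fix ys assume ys: "ys \<in> level (Suc j)"
    then have "ys \<noteq> []" by (auto simp: level_def)
    then have "ys = butlast ys @ [last ys]" by simp
    moreover have "butlast ys \<in> level j" "last ys \<in> inner"
      using ys \<open>ys \<noteq> []\<close> by (auto simp: level_def dest: in_set_butlastD)
    ultimately show "ys \<in> (\<lambda>(xs, w). xs @ [w]) ` (level j \<times> inner)" by force
  qed
qed (auto simp: level_def)

lemma card_level_Suc:
  "card {ys \<in> level (Suc j). P ys} = (\<Sum>xs\<in>level j. card {w \<in> inner. P (xs @ [w])})"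
proof -
  let ?A = "SIGMA xs : level j. {w \<in> inner. P (xs @ [w])}"
  have "{ys \<in> level (Suc j). P ys} = (\<lambda>(xs, w). xs @ [w]) ` ?A"
    unfolding level_Suc by auto
  moreover have "inj_on (\<lambda>(xs, w). xs @ [w]) ?A" by (auto simp: inj_on_def)
  ultimately have "card {ys \<in> level (Suc j). P ys} = card ?A" by (simp add: card_image)
  then show ?thesis using finite_level finite_inner by simp
qed

section \<open>Projection onto one copy and the price of a copy\<close>

definition proj :: "nat list list \<Rightarrow> nat list list \<Rightarrow> nat list" where
  "proj xs ys = (if prefix xs ys \<and> length xs < length ys then ys ! length xs else [0])"

lemma proj_place_same: "proj xs (place xs g) = g"
  by (auto simp: proj_def place_def)

lemma proj_place_other:
  assumes "xs \<noteq> ys"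
  shows "proj xs (place ys g) = proj xs ys"
proof (cases "prefix xs ys")
  case True
  then have "length xs < length ys"
    using assms by (meson prefix_length_less strict_prefix_def)
  then show ?thesis using True by (auto simp: proj_def place_def nth_append)
next
  case False
  then show ?thesis by (auto simp: proj_def place_def)
qed

text \<open>\<open>proj xs\<close> sends everything hanging below a node of the copy at
  \<open>xs\<close> to that node and everything else to its root. Any other copy collapses to one
  node, and the edges of this copy are preserved.\<close>

lemma linked_proj:
  assumes F: "F \<subseteq> tree_edges" and "linked F u v"
  shows "linked {g \<in> sedges. place xs ` g \<in> F} (proj xs u) (proj xs v)"
  using assms(2)
proof (rule linked_map)
  fix a b assume ab: "{a, b} \<in> F"
  then obtain ys g where g: "g \<in> sedges" "{a, b} = place ys ` g"
    using F by (auto simp: tree_edges_def copy_def)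
  show "proj xs a = proj xs b \<or> {proj xs a, proj xs b} \<in> {g \<in> sedges. place xs ` g \<in> F}"
  proof (cases "xs = ys")
    case True
    have "{proj xs a, proj xs b} = proj xs ` place xs ` g"
      using g(2) True by (metis image_empty image_insert)
    also have "\<dots> = g" by (simp add: image_image proj_place_same)
    finally show ?thesis using g ab True by auto
  next
    case False
    have "a \<in> place ys ` g" "b \<in> place ys ` g" using g(2) by blast+
    then show ?thesis using proj_place_other[OF False] by auto
  qed
qed

text \<open>Collapsing the subtree at \<open>xs\<close> to the vertex \<open>xs\<close> contracts
  the edges inside it and fixes all others, so a walk into the subtree becomes a walk to
  \<open>xs\<close>.\<close>

lemma linked_prefix:
  assumes F: "F \<subseteq> tree_edges" and "linked F [] (xs @ [w])"
  shows "linked F [] xs"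
proof -
  define trunc where "trunc ys = (if prefix xs ys then xs else ys)" for ys
  have "linked F (trunc []) (trunc (xs @ [w]))"
    using assms(2)
  proof (rule linked_map)
    fix a b assume ab: "{a, b} \<in> F"
    then obtain zs g where g: "g \<in> sedges" "{a, b} = place zs ` g"
      using F by (auto simp: tree_edges_def copy_def)
    have "trunc (place zs h) = (if prefix xs zs then xs else place zs h)" for h
      by (auto simp: trunc_def place_def)
    moreover have "a \<in> place zs ` g" "b \<in> place zs ` g" using g(2) by blast+
    ultimately show "trunc a = trunc b \<or> {trunc a, trunc b} \<in> F" using ab by auto
  qed
  then show ?thesis by (auto simp: trunc_def split: if_splits)
qed

text \<open>Walks from the global root enter a copy only through its root. If that root is connected
  to the global root, every inner node reached takes an extra edge. If not, no inner node is
  reached, and the original vertices still need n - 1 complete paths.\<close>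

lemma card_copy_ge:
  assumes F: "F \<subseteq> tree_edges" and hard: "\<And>v. v < n \<Longrightarrow> linked F xs (place xs [v])"
  shows "(if linked F [] xs then n - 1 else (n - 1) * (k + 1)) + card {w \<in> inner. linked F [] (xs @ [w])}
    \<le> card (F \<inter> copy xs)"
proof -
  let ?A = "{g \<in> sedges. place xs ` g \<in> F}" and ?W = "{w \<in> inner. linked F [] (xs @ [w])}"
  have conn: "linked ?A [0] [v]" if "v < n" for v
    using linked_proj[OF F hard[OF that], of xs] proj_place_same[of xs "[v]"] by (simp add: proj_def)
  show ?thesis
  proof (cases "linked F [] xs")
    case True
    have "linked ?A [0] w" if "w \<in> ?W" for w
      using linked_proj[OF F, of "[]" "xs @ [w]" xs] that by (simp add: proj_def)
    then have "n - 1 + card ?W \<le> card ?A" using conn by (intro card_spanning_sedges_inner) auto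
    then show ?thesis using True by (simp add: card_copy_Int)
  next
    case False
    then have "card ?W = 0" using linked_prefix[OF F] by (auto simp: card_eq_0_iff)
    moreover have "(n - 1) * (k + 1) \<le> card ?A" using conn by (intro card_spanning_sedges) auto
    ultimately show ?thesis unfolding card_copy_Int using False by simp
  qed
qed

subsection \<open>The instance on the tree of copies\<close>

definition \<tau> :: real where "\<tau> = real (n - 1) / real (card E0)"

text \<open>The number of inner nodes per edge of the subdivided multigraph; the distance from 1 is
  the loss due to finite subdivision.\<close>

definition \<sigma> :: real where "\<sigma> = real k / real (k + 1)"

text \<open>Every level has total cost \<open>1 / m\<close>, and its vertices have total penalty \<open>\<sigma> * (1 - \<tau>) / m\<close>.\<close>

definition tree_cost :: "nat \<Rightarrow> real" where
  "tree_cost j = 1 / (real m * real (card inner) ^ j * real (card sedges))"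

text \<open>Penalty 1 on original vertices already exceeds the lower bound sought, so violating one
  such pair is never worthwhile. A target of length j + 1 belongs to the copy level j.\<close>

definition tree_penalty :: "nat list list \<Rightarrow> real" where
  "tree_penalty t = (if last t \<in> inner
     then \<sigma> * (1 - \<tau>) / (real m * real (card inner) ^ length t) else 1)"

text \<open>An inner node is paired with the global root \<open>[]\<close>, an original vertex with
  the root of its own copy, whose place is \<open>butlast t\<close>.\<close>

definition source :: "nat list list \<Rightarrow> nat list list" where
  "source t = (if last t \<in> inner then [] else butlast t)"

definition target :: "nat \<Rightarrow> nat list list" where
  "target = (SOME h. bij_betw h {..<card targets} targets)"

definition tree_instance :: "nat list list pcsf" where
  "tree_instance = \<lparr>verts = tree_verts, edges = tree_edges,
     cost = (\<lambda>e. tree_cost (Max (length ` e) - 1)), npairs = card targets,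
     src = source \<circ> target, tgt = target, penalty = tree_penalty \<circ> target\<rparr>"

lemma bij_target: "bij_betw target {..<card targets} targets"
  unfolding target_def
  using ex_bij_betw_nat_finite[OF finite_targets] unfolding lessThan_atLeast0 by (rule someI_ex)

lemma target_in: "i < card targets \<Longrightarrow> target i \<in> targets"
  using bij_betwE[OF bij_target] by auto

lemma tau: "0 < \<tau>" "\<tau> \<le> 1"
  using tree_card n_ge E0_ne by (auto simp: \<tau>_def)

lemma sigma: "0 < \<sigma>" "\<sigma> \<le> 1"
  using k_pos by (auto simp: \<sigma>_def)

lemma card_inner_pos: "0 < card inner"
  using card_inner k_pos E0_ne by simp

lemma card_sedges_pos: "0 < card sedges"
  using card_sedges E0_ne by simp

lemma tree_cost_pos: "0 < tree_cost j"
  using m_pos card_inner_pos card_sedges_pos by (simp add: tree_cost_def)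

lemma tree_penalty_nonneg: "0 \<le> tree_penalty t"
  using tau sigma by (simp add: tree_penalty_def)

lemma pcsf_instance_tree: "pcsf_instance tree_instance"
proof -
  have "source t \<in> tree_verts" if "t \<in> targets" for t
  proof -
    obtain xs g where "xs \<in> addresses" "t = xs @ [g]" using \<open>t \<in> targets\<close> by (auto simp: targets_def)
    then show ?thesis using address_in_verts Nil_address by (auto simp: source_def)
  qed
  then show ?thesis
    using ugraph_tree targets_in_verts target_in tree_cost_pos tree_penalty_nonneg
    by (auto simp: pcsf_instance_def tree_instance_def less_imp_le)
qed

lemma sum_targets:
  "(\<Sum>i | i < card targets \<and> P (target i). f (target i)) = (\<Sum>t | t \<in> targets \<and> P t. f t)"
proof -
  have "bij_betw target {i. i < card targets \<and> P (target i)} {t \<in> targets. P t}"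
    using bij_target by (auto simp: bij_betw_def inj_on_def)
  then show ?thesis by (rule sum.reindex_bij_betw)
qed

lemma soft_targets: "{t \<in> targets. last t \<in> inner} = (\<Union>j<m. level (Suc j))"
proof -
  have "{t \<in> targets. last t \<in> inner} = (\<Union>xs\<in>addresses. (\<lambda>w. xs @ [w]) ` inner)"
  proof -
    have "inner \<subseteq> nodes - {[0]}" using single_notin_inner by (auto simp: nodes_def)
    then have "xs @ [w] \<in> targets" if "xs \<in> addresses" "w \<in> inner" for xs w
      using that unfolding targets_def by blast
    then show ?thesis by (auto simp: targets_def)
  qed
  also have "\<dots> = (\<Union>j<m. level (Suc j))" by (auto simp: addresses_def level_Suc)
  finally show ?thesis .
qed

lemma sum_soft_targets:
  "(\<Sum>t | t \<in> targets \<and> last t \<in> inner \<and> P t. tree_penalty t) =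
   (\<Sum>j<m. \<sigma> * (1 - \<tau>) / (real m * real (card inner) ^ Suc j) * real (card {t \<in> level (Suc j). P t}))"
proof -
  have *: "last t \<in> inner" if "t \<in> level (Suc j)" for t j
    using that by (auto simp: level_Suc)
  have "{t \<in> targets. last t \<in> inner \<and> P t} = (\<Union>j<m. {t \<in> level (Suc j). P t})"
    using soft_targets by blast
  then have "(\<Sum>t | t \<in> targets \<and> last t \<in> inner \<and> P t. tree_penalty t) =
      sum tree_penalty (\<Union>j<m. {t \<in> level (Suc j). P t})"
    by (rule arg_cong)
  also have "\<dots> = (\<Sum>j<m. \<Sum>t | t \<in> level (Suc j) \<and> P t. tree_penalty t)"
  proof (rule sum.UNION_disjoint)
    show "\<forall>i\<in>{..<m}. \<forall>j\<in>{..<m}. i \<noteq> j \<longrightarrow>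
      {t \<in> level (Suc i). P t} \<inter> {t \<in> level (Suc j). P t} = {}"
      by (auto simp: level_def)
  qed (simp_all add: finite_level)
  also have "\<dots> = (\<Sum>j<m. \<Sum>t | t \<in> level (Suc j) \<and> P t.
      \<sigma> * (1 - \<tau>) / (real m * real (card inner) ^ Suc j))"
    using * by (intro sum.cong) (auto simp: tree_penalty_def level_def)
  finally show ?thesis by (simp add: mult.commute)
qed

text \<open>Summing \<open>card_copy_ge\<close> over level j bounds m times its cost by q j * \<tau>
  * (1 - \<sigma>) + (1 - q j) * \<tau> + \<sigma> * q (j + 1). The penalties add \<sigma> * (1 -
  \<tau>) * (1 - q (j + 1)); their weight is chosen so that q j and q (j + 1) get opposite
  coefficients and the levels telescope.\<close>

lemma level_bound:
  assumes F: "F \<subseteq> tree_edges" and j: "j < m"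
    and hard: "\<And>xs v. xs \<in> addresses \<Longrightarrow> v < n \<Longrightarrow> linked F xs (place xs [v])"
    and q: "\<And>j. q j = real (card {xs \<in> level j. linked F [] xs}) / real (card inner) ^ j"
  shows "1 / real m * (\<tau> + \<sigma> * (1 - \<tau>) + \<sigma> * \<tau> * (q (Suc j) - q j))
    \<le> tree_cost j * real (\<Sum>xs\<in>level j. card (F \<inter> copy xs)) +
      \<sigma> * (1 - \<tau>) / (real m * real (card inner) ^ Suc j) *
        real (card {t \<in> level (Suc j). \<not> linked F [] t})"
proof -
  define N where "N = real (card inner)"
  define M where "M = real (card sedges)"
  define Q where "Q j = card {xs \<in> level j. linked F [] xs}" for j
  have pos: "0 < N" "0 < M" "0 < real m"
    using card_inner_pos card_sedges_pos m_pos by (auto simp: N_def M_def)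
  \<comment> \<open>Dividing by the number of edges of a copy expresses the counts of inner nodes,
    of tree edges and of edges on complete paths through \<tau> and \<sigma>.\<close>
  have NM: "N / M = \<sigma>" "real (n - 1) / M = \<tau> * (1 - \<sigma>)" "real ((n - 1) * (k + 1)) / M = \<tau>"
  proof -
    define c where "c = real (card E0)"
    define K where "K = real k"
    define r where "r = real (n - 1)"
    have c: "0 < c" "0 < K" using E0_ne k_pos by (auto simp: c_def K_def)
    have eqs: "N = K * c" "M = c * (K + 1)" "\<sigma> = K / (K + 1)" "\<tau> = r / c" "real (n - 1) = r"
      "real ((n - 1) * (k + 1)) = r * (K + 1)"
      by (simp_all only: N_def M_def \<sigma>_def \<tau>_def c_def K_def r_def card_inner card_sedges
          of_nat_mult of_nat_add of_nat_1)
    show "N / M = \<sigma>" "real (n - 1) / M = \<tau> * (1 - \<sigma>)" "real ((n - 1) * (k + 1)) / M = \<tau>"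
      unfolding eqs using c by (simp_all add: divide_simps)
  qed
  have Q: "real (Q i) = q i * N ^ i" for i using pos q[of i] by (simp add: Q_def N_def)
  have compl: "real (card {t \<in> level i. \<not> linked F [] t}) = N ^ i * (1 - q i)" for i
  proof -
    have "card (level i) = card {t \<in> level i. \<not> linked F [] t} + Q i"
    proof -
      have "card ({t \<in> level i. \<not> linked F [] t} \<union> {t \<in> level i. linked F [] t}) =
          card {t \<in> level i. \<not> linked F [] t} + Q i"
        unfolding Q_def by (rule card_Un_disjoint) (auto simp: finite_level)
      moreover have "{t \<in> level i. \<not> linked F [] t} \<union> {t \<in> level i. linked F [] t} = level i" by auto
      ultimately show ?thesis by simp
    qed
    then have "N ^ i = real (card {t \<in> level i. \<not> linked F [] t}) + Q i"
      by (metis N_def card_level of_nat_add of_nat_power)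
    then show ?thesis using Q[of i] by (simp add: algebra_simps)
  qed
  let ?g = "\<lambda>xs. if linked F [] xs then n - 1 else (n - 1) * (k + 1)"
  have "(\<Sum>xs\<in>level j. ?g xs) + Q (Suc j) =
      (\<Sum>xs\<in>level j. ?g xs + card {w \<in> inner. linked F [] (xs @ [w])})"
    unfolding Q_def card_level_Suc by (simp add: sum.distrib)
  also have "\<dots> \<le> (\<Sum>xs\<in>level j. card (F \<inter> copy xs))"
    using j by (intro sum_mono card_copy_ge[OF F] hard) (auto simp: addresses_def)
  finally have *: "(\<Sum>xs\<in>level j. ?g xs) + Q (Suc j) \<le> (\<Sum>xs\<in>level j. card (F \<inter> copy xs))" .
  have "(\<Sum>xs\<in>level j. ?g xs) = Q j * (n - 1) +
      card {t \<in> level j. \<not> linked F [] t} * ((n - 1) * (k + 1))"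
    unfolding Q_def using finite_level by (simp add: sum.If_cases Int_def)
  then have "real (\<Sum>xs\<in>level j. ?g xs) = real (Q j) * real (n - 1) +
      real (card {t \<in> level j. \<not> linked F [] t}) * real ((n - 1) * (k + 1))"
    by (simp only: of_nat_add of_nat_mult)
  also have "\<dots> = N ^ j * (q j * real (n - 1) + (1 - q j) * real ((n - 1) * (k + 1)))"
    unfolding Q compl by algebra
  finally have "N ^ j * (q j * real (n - 1) + (1 - q j) * real ((n - 1) * (k + 1)) + N * q (Suc j))
      = real ((\<Sum>xs\<in>level j. ?g xs) + Q (Suc j))"
    unfolding of_nat_add Q power_Suc by (simp only: distrib_left mult_ac)
  also have "\<dots> \<le> real (\<Sum>xs\<in>level j. card (F \<inter> copy xs))"
    using * by (rule of_nat_mono)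
  finally have "tree_cost j *
        (N ^ j * (q j * real (n - 1) + (1 - q j) * real ((n - 1) * (k + 1)) + N * q (Suc j)))
      \<le> tree_cost j * real (\<Sum>xs\<in>level j. card (F \<inter> copy xs))"
    using tree_cost_pos[of j] by (intro mult_left_mono) auto
  moreover have "tree_cost j *
        (N ^ j * (q j * real (n - 1) + (1 - q j) * real ((n - 1) * (k + 1)) + N * q (Suc j)))
      = 1 / real m * (q j * (real (n - 1) / M) +
          (1 - q j) * (real ((n - 1) * (k + 1)) / M) + N / M * q (Suc j))"
    using pos unfolding tree_cost_def N_def[symmetric] M_def[symmetric]
    by (simp add: add_divide_distrib distrib_left)
  moreover have "\<sigma> * (1 - \<tau>) / (real m * N ^ Suc j) * real (card {t \<in> level (Suc j). \<not> linked F [] t})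
      = 1 / real m * (\<sigma> * (1 - \<tau>) * (1 - q (Suc j)))"
    unfolding compl using pos by (simp add: field_simps)
  moreover have "1 / real m * (\<tau> + \<sigma> * (1 - \<tau>) + \<sigma> * \<tau> * (q (Suc j) - q j)) =
      1 / real m * (q j * (\<tau> * (1 - \<sigma>)) + (1 - q j) * \<tau> + \<sigma> * q (Suc j)) +
      1 / real m * (\<sigma> * (1 - \<tau>) * (1 - q (Suc j)))"
    by (simp add: algebra_simps)
  ultimately show ?thesis unfolding NM N_def[symmetric] by linarith
qed

text \<open>Either some original vertex is cut off from the root of its copy, which costs a penalty
  of 1, or \<open>level_bound\<close> holds on every level and the sum telescopes.\<close>

lemma forest_bound:
  assumes F: "F \<subseteq> edges tree_instance"
  shows "\<sigma> - 1 / real m \<le> forest_cost tree_instance F + forest_penalty tree_instance F"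
proof -
  let ?U = "\<lambda>t. \<not> linked F (source t) t"
  have F': "F \<subseteq> tree_edges" using F by (simp add: tree_instance_def)
  have pen: "forest_penalty tree_instance F = (\<Sum>t | t \<in> targets \<and> ?U t. tree_penalty t)"
    unfolding forest_penalty_def using sum_targets[where P = ?U and f = tree_penalty]
    by (simp add: tree_instance_def)
  have cost: "forest_cost tree_instance F =
      (\<Sum>j<m. tree_cost j * real (\<Sum>xs\<in>level j. card (F \<inter> copy xs)))"
    unfolding forest_cost_def using sum_tree_edges[OF F', of tree_cost] by (simp add: tree_instance_def)
  show ?thesis
  proof (cases "\<forall>xs\<in>addresses. \<forall>v<n. linked F xs (place xs [v])")
    case True
    define q where "q j = real (card {xs \<in> level j. linked F [] xs}) / real (card inner) ^ j" for j
    have "level 0 = {[]}" by (auto simp: level_def)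
    then have "{xs \<in> level 0. linked F [] xs} = {[]}" using linked_refl by auto
    then have q0: "q 0 = 1" by (simp add: q_def)
    have qm: "0 \<le> q m" by (simp add: q_def)
    have "\<tau> + \<sigma> * (1 - \<tau>) + \<sigma> * \<tau> * (q m - q 0) / real m =
        (\<Sum>j<m. 1 / real m * (\<tau> + \<sigma> * (1 - \<tau>) + \<sigma> * \<tau> * (q (Suc j) - q j)))"
    proof -
      have "(\<Sum>j<m. 1 / real m * (\<tau> + \<sigma> * (1 - \<tau>) + \<sigma> * \<tau> * (q (Suc j) - q j))) =
          1 / real m * (real m * (\<tau> + \<sigma> * (1 - \<tau>)) + \<sigma> * \<tau> * (\<Sum>j<m. q (Suc j) - q j))"
        by (simp only: sum_distrib_left[symmetric] sum.distrib sum_constant card_lessThan)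
          (simp add: algebra_simps)
      then show ?thesis using m_pos by (simp add: sum_lessThan_telescope field_simps)
    qed
    also have "\<dots> \<le> (\<Sum>j<m. tree_cost j * real (\<Sum>xs\<in>level j. card (F \<inter> copy xs)) +
        \<sigma> * (1 - \<tau>) / (real m * real (card inner) ^ Suc j) *
          real (card {t \<in> level (Suc j). \<not> linked F [] t}))"
      using True by (intro sum_mono level_bound[OF F']) (auto simp: q_def)
    also have "\<dots> = forest_cost tree_instance F +
        (\<Sum>t | t \<in> targets \<and> last t \<in> inner \<and> \<not> linked F [] t. tree_penalty t)"
      unfolding cost sum_soft_targets by (simp only: sum.distrib)
    also have "(\<Sum>t | t \<in> targets \<and> last t \<in> inner \<and> \<not> linked F [] t. tree_penalty t) \<le>
        forest_penalty tree_instance F"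
      unfolding pen using finite_targets tree_penalty_nonneg
      by (intro sum_mono2) (auto simp: source_def)
    finally have "\<tau> + \<sigma> * (1 - \<tau>) + \<sigma> * \<tau> * (q m - q 0) / real m
        \<le> forest_cost tree_instance F + forest_penalty tree_instance F" by simp
    \<comment> \<open>The telescoping error is smallest when q falls from q 0 = 1 to q m =
      0.\<close>
    moreover have "- (1 / real m) \<le> \<sigma> * \<tau> * (q m - q 0) / real m"
    proof -
      have "\<sigma> * \<tau> \<le> 1" using sigma tau by (simp add: mult_le_one)
      moreover have "\<sigma> * \<tau> * (q m - q 0) = \<sigma> * \<tau> * q m - \<sigma> * \<tau>" using q0 by (simp add: algebra_simps)
      moreover have "0 \<le> \<sigma> * \<tau> * q m" using sigma tau qm by simp
      ultimately have "- 1 \<le> \<sigma> * \<tau> * (q m - q 0)" by linarith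
      then show ?thesis using m_pos by (simp add: field_simps)
    qed
    moreover have "\<sigma> * \<tau> \<le> 1 * \<tau>" using sigma tau by (intro mult_right_mono) auto
    then have "\<sigma> \<le> \<tau> + \<sigma> * (1 - \<tau>)" by (simp add: algebra_simps)
    ultimately show ?thesis by linarith
  next
    case False
    then obtain xs v where xv: "xs \<in> addresses" "v < n" "\<not> linked F xs (place xs [v])" by blast
    \<comment> \<open>The node \<open>[0]\<close> is placed at \<open>xs\<close> itself, so it is
      trivially connected and is not a target.\<close>
    then have v: "v \<noteq> 0" using linked_refl[of F xs] by (cases "v = 0") (auto simp: place_def)
    define t where "t = xs @ [[v]]"
    have t: "t \<in> targets" using xv v single_in_nodes by (auto simp: t_def targets_def)
    moreover have "?U t" using xv v single_notin_inner by (simp add: t_def source_def place_def)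
    ultimately have "tree_penalty t \<le> forest_penalty tree_instance F"
      unfolding pen using finite_targets tree_penalty_nonneg by (intro member_le_sum) auto
    moreover have "tree_penalty t = 1" using single_notin_inner by (simp add: t_def tree_penalty_def)
    moreover have "0 \<le> forest_cost tree_instance F"
      unfolding forest_cost_def tree_instance_def pcsf.simps
      by (intro sum_nonneg less_imp_le tree_cost_pos)
    moreover have "\<sigma> - 1 / real m \<le> 1" using sigma(2) m_pos by (simp add: add_increasing2 diff_le_eq)
    ultimately show ?thesis by linarith
  qed
qed

section \<open>The fractional solution and its value\<close>

definition tree_z :: "nat \<Rightarrow> real" where
  "tree_z i = (if last (target i) \<in> inner then 1 - 2 / real d else 0)"

lemma card_cut_tree:
  assumes "xs \<in> addresses"
  shows "card {g \<in> sedges. card (g \<inter> place xs -` S) = 1} \<le> card (cut tree_instance S)"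
proof (rule card_inj_on_le)
  show "inj_on (\<lambda>g. place xs ` g) {g \<in> sedges. card (g \<inter> place xs -` S) = 1}"
    by (rule inj_onI) (simp add: inj_image_eq_iff[OF inj_place])
  show "(\<lambda>g. place xs ` g) ` {g \<in> sedges. card (g \<inter> place xs -` S) = 1} \<subseteq> cut tree_instance S"
  proof clarify
    fix g assume g: "g \<in> sedges" "card (g \<inter> place xs -` S) = 1"
    have "place xs ` g \<inter> S = place xs ` (g \<inter> place xs -` S)" by auto
    then have "card (place xs ` g \<inter> S) = 1"
      using g(2) inj_place[of xs] by (simp add: card_image inj_on_subset)
    then show "place xs ` g \<in> cut tree_instance S"
      using g(1) assms by (auto simp: cut_def tree_instance_def tree_edges_def copy_def)
  qed
  have "tree_edges \<subseteq> Pow tree_verts" "finite tree_verts" using ugraph_tree by (auto simp: ugraph_def)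
  then have "finite tree_edges" using finite_subset by blast
  then show "finite (cut tree_instance S)" by (simp add: cut_def tree_instance_def)
qed

text \<open>A pair inside one copy is separated by at least d edges of value 1 / d. For an inner
  target, S changes between two consecutive prefixes of its address, so some copy contributes at
  least two cut edges, and \<open>tree_z\<close> supplies the missing 1 - 2 / d.\<close>

lemma lp_feasible_tree: "lp_feasible tree_instance (\<lambda>_. 1 / real d) tree_z"
  unfolding lp_feasible_def
proof (intro conjI allI impI ballI)
  fix S i assume i: "i < npairs tree_instance" and sep: "separates tree_instance i S"
  define t where "t = target i"
  have "t \<in> targets" using i target_in by (simp add: t_def tree_instance_def)
  then obtain xs g where t: "xs \<in> addresses" "g \<in> nodes" "g \<noteq> [0]" "t = xs @ [g]"
    by (auto simp: targets_def)
  have sep': "(source t \<in> S) \<noteq> (t \<in> S)" using sep by (simp add: separates_def tree_instance_def t_def)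
  have d0: "0 < real d" using d_ge by simp
  show "1 \<le> (\<Sum>e\<in>cut tree_instance S. 1 / real d) + tree_z i"
  proof (cases "g \<in> inner")
    case True
    have "([] \<in> S) \<noteq> (t \<in> S)" using sep' True t(4) by (simp add: source_def)
    then have "\<exists>j<length t. (take j t \<in> S) \<noteq> (take (Suc j) t \<in> S)"
      using ex_change_between[of 0 "length t" "\<lambda>j. take j t \<in> S"] by auto
    then obtain j where j: "j < length t" "(take j t \<in> S) \<noteq> (take (Suc j) t \<in> S)" by blast
    have inn: "set t \<subseteq> inner" "length t \<le> m" using t(1,4) True by (auto simp: addresses_iff)
    then have w: "t ! j \<in> inner" and ad: "take j t \<in> addresses"
      using j(1) set_take_subset[of j t] by (auto simp: addresses_iff)
    have "place (take j t) (t ! j) = take (Suc j) t"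
      using w single_notin_inner j(1) by (auto simp: place_def take_Suc_conv_app_nth)
    then have "([0] \<in> place (take j t) -` S) \<noteq> (t ! j \<in> place (take j t) -` S)"
      using j(2) by (simp add: place_def)
    from cut_sedges_inner[OF w this] card_cut_tree[OF ad, of S]
    have "2 \<le> real (card (cut tree_instance S))" by linarith
    then have "2 / real d \<le> real (card (cut tree_instance S)) / real d"
      using d0 by (intro divide_right_mono) auto
    then show ?thesis using True t(4) by (simp add: tree_z_def t_def[symmetric])
  next
    case False
    then obtain v where v: "v < n" "g = [v]" using t(2) by (auto simp: nodes_def)
    have "([0] \<in> place xs -` S) \<noteq> ([v] \<in> place xs -` S)"
      using sep' False t(3,4) v by (simp add: source_def place_def)
    then have "d \<le> card {g \<in> sedges. card (g \<inter> place xs -` S) = 1}"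
      using cut_sedges_original[of 0 v "place xs -` S"]
        cut_sedges_original[of v 0 "place xs -` S"] v(1) n_ge
      by linarith
    then have "real d \<le> real (card (cut tree_instance S))"
      using card_cut_tree[OF t(1), of S] by linarith
    then show ?thesis using d0 False t(4) by (simp add: tree_z_def t_def[symmetric])
  qed
qed (use d_ge in \<open>auto simp: tree_z_def\<close>)

lemma lp_cost_tree: "(\<Sum>e\<in>edges tree_instance. cost tree_instance e * (1 / real d)) = 1 / real d"
proof -
  have copy: "card (tree_edges \<inter> copy xs) = card sedges" if "xs \<in> level j" "j < m" for xs j
  proof -
    have "{g \<in> sedges. place xs ` g \<in> tree_edges} = sedges"
      using that by (auto simp: tree_edges_def copy_def addresses_def)
    then show ?thesis by (simp add: card_copy_Int)
  qed
  have "(\<Sum>e\<in>edges tree_instance. cost tree_instance e) =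
      (\<Sum>j<m. tree_cost j * real (\<Sum>xs\<in>level j. card (tree_edges \<inter> copy xs)))"
    using sum_tree_edges[of tree_edges tree_cost] by (simp add: tree_instance_def)
  also have "\<dots> = (\<Sum>j<m. 1 / real m)"
  proof (rule sum.cong)
    fix j assume "j \<in> {..<m}"
    then have "(\<Sum>xs\<in>level j. card (tree_edges \<inter> copy xs)) = (\<Sum>xs\<in>level j. card sedges)"
      using copy by (intro sum.cong) auto
    then show "tree_cost j * real (\<Sum>xs\<in>level j. card (tree_edges \<inter> copy xs)) = 1 / real m"
      using card_inner_pos card_sedges_pos by (simp add: tree_cost_def card_level)
  qed simp
  also have "\<dots> = 1" using m_pos by simp
  finally show ?thesis by (simp add: sum_divide_distrib[symmetric])
qed

lemma lp_penalty_tree: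
  "(\<Sum>i<npairs tree_instance. penalty tree_instance i * tree_z i) \<le> (1 - 2 / real d) * (1 - \<tau>)"
proof -
  have "(\<Sum>i<npairs tree_instance. penalty tree_instance i * tree_z i) =
      (\<Sum>i<card targets. if last (target i) \<in> inner
        then tree_penalty (target i) * (1 - 2 / real d) else 0)"
    by (intro sum.cong) (auto simp: tree_z_def tree_instance_def)
  also have "\<dots> = (\<Sum>i | i < card targets \<and> last (target i) \<in> inner.
      tree_penalty (target i) * (1 - 2 / real d))"
    by (simp add: sum.If_cases Int_def)
  also have "\<dots> = (\<Sum>t | t \<in> targets \<and> last t \<in> inner. tree_penalty t * (1 - 2 / real d))"
    by (rule sum_targets)
  \<comment> \<open>The conjunct \<open>True\<close> brings the sum into the form of
    \<open>sum_soft_targets\<close>.\<close>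
  also have "\<dots> = (\<Sum>t | t \<in> targets \<and> last t \<in> inner \<and> True. tree_penalty t) * (1 - 2 / real d)"
    by (simp add: sum_distrib_right)
  also have "(\<Sum>t | t \<in> targets \<and> last t \<in> inner \<and> True. tree_penalty t) = (\<Sum>j<m. \<sigma> * (1 - \<tau>) / real m)"
    unfolding sum_soft_targets using card_inner_pos by (simp add: card_level)
  also have "\<dots> = \<sigma> * (1 - \<tau>)" using m_pos by simp
  also have "\<sigma> * (1 - \<tau>) * (1 - 2 / real d) \<le> 1 * (1 - \<tau>) * (1 - 2 / real d)"
    using sigma tau d_ge by (intro mult_right_mono) auto
  finally show ?thesis by (simp add: mult.commute)
qed

lemma tree_positive:
  "e \<in> edges tree_instance \<Longrightarrow> 0 < cost tree_instance e"
  "\<exists>i < npairs tree_instance. 0 < penalty tree_instance i \<and>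
      src tree_instance i \<noteq> tgt tree_instance i"
proof -
  show "0 < cost tree_instance e" if "e \<in> edges tree_instance" for e
    by (simp add: tree_instance_def tree_cost_pos)
  \<comment> \<open>Vertex 1 of the top copy is original, so its pair has penalty 1 and source
    \<open>[]\<close>.\<close>
  have "[[1]] \<in> targets" using Nil_address single_in_nodes[of 1] n_ge by (force simp: targets_def)
  then have "[[1]] \<in> target ` {..<card targets}" using bij_target by (simp add: bij_betw_def)
  then obtain i where "i < card targets" "target i = [[1]]" by auto
  then show "\<exists>i < npairs tree_instance. 0 < penalty tree_instance i \<and>
      src tree_instance i \<noteq> tgt tree_instance i"
    using single_notin_inner by (intro exI[of _ i])
      (simp add: tree_instance_def source_def tree_penalty_def)
qed

end

subsection \<open>Planarity of the tree of copies\<close>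

lemma append_less_append_iff: "xs @ ys < xs @ zs \<longleftrightarrow> ys < (zs :: 'a :: linorder list)"
  by (induction xs) auto

lemma prefix_imp_le: "prefix xs ys \<Longrightarrow> xs \<le> (ys :: 'a :: linorder list)"
proof -
  have "xs \<le> xs @ zs" for zs :: "'a list" by (induction xs) auto
  then show "prefix xs ys \<Longrightarrow> xs \<le> ys" by (auto elim: prefixE)
qed

text \<open>This makes each subtree occupy an interval of the spine of the book embedding.\<close>

lemma prefix_between:
  fixes as :: "'a :: linorder list"
  assumes "prefix p as" "prefix p bs" "as \<le> cs" "cs \<le> bs"
  shows "prefix p cs"
  using assms
proof (induction p arbitrary: as bs cs)
  case (Cons x p)
  obtain as' bs' where *: "as = x # as'" "bs = x # bs'" "prefix p as'" "prefix p bs'"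
    using Cons.prems(1,2) by (auto simp: prefix_def)
  then obtain y cs' where c: "cs = y # cs'" using Cons.prems(3) by (cases cs) auto
  then have "y = x" "as' \<le> cs'" "cs' \<le> bs'" using Cons.prems(3,4) * by auto
  then show ?case using Cons.IH[OF *(3,4)] c by simp
qed simp

context copy_tree
begin

text \<open>The root \<open>[0]\<close> is the least node, which matches its place \<open>xs\<close>
  preceding all extensions of \<open>xs\<close>.\<close>

lemma place_less_iff:
  assumes "g \<in> nodes" "h \<in> nodes"
  shows "place xs g < place xs h \<longleftrightarrow> g < h"
proof -
  have *: "[0] < g" if "g \<in> nodes" "g \<noteq> [0]" for g
    using that by (auto simp: nodes_def inner_def)
  have "\<not> xs @ [h] < xs" for h :: "nat list"
    using append_less_append_iff[of xs "[h]" "[]"] by simp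
  moreover have "xs < xs @ [h]" for h :: "nat list"
    using append_less_append_iff[of xs "[]" "[h]"] by simp
  ultimately show ?thesis
    using *[OF assms(1)] *[OF assms(2)] append_less_append_iff[of xs "[g]" "[h]"]
    by (auto simp: place_def)
qed

text \<open>If one copy lies below a node p of the other, crossing edges would put an end of the
  other copy's edge into the interval of p. That end must be p, the least element of the interval,
  against the assumed order. Incomparable copies occupy disjoint intervals.\<close>

lemma copies_noncrossing:
  assumes "xs \<noteq> ys" and ab: "a = place xs g1" "b = place xs g2"
    and cd: "c = place ys h1" "d' = place ys h2"
    and less: "a < c" "c < b" "b < d'"
  shows False
proof -
  have pre: "prefix zs (place zs g)" for zs g by (auto simp: place_def)
  consider "strict_prefix xs ys" | "strict_prefix ys xs" | "\<not> prefix xs ys" "\<not> prefix ys xs"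
    using assms(1) by (auto simp: strict_prefix_def)
  then show False
  proof cases
    case 1
    then obtain g zs where ys: "ys = xs @ g # zs" by (rule strict_prefixE')
    let ?p = "xs @ [g]"
    have p: "prefix ?p c" "prefix ?p d'" using cd ys by (auto simp: place_def)
    then have "prefix ?p b" using less by (intro prefix_between[of ?p c d' b]) auto
    then have "b = ?p" using ab(2) by (auto simp: place_def split: if_splits)
    then show False using prefix_imp_le[OF p(1)] less(2) by simp
  next
    case 2
    then obtain g zs where xs: "xs = ys @ g # zs" by (rule strict_prefixE')
    let ?p = "ys @ [g]"
    have p: "prefix ?p a" "prefix ?p b" using ab xs by (auto simp: place_def)
    then have "prefix ?p c" using less by (intro prefix_between[of ?p a b c]) auto
    then have "c = ?p" using cd(1) by (auto simp: place_def split: if_splits)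
    then show False using prefix_imp_le[OF p(1)] less(1) by simp
  next
    case 3
    have "prefix xs a" "prefix xs b" using ab pre by simp_all
    then have "prefix xs c" using less by (intro prefix_between[of xs a b c]) auto
    then show False using cd(1) 3 by (auto simp: place_def split: if_splits)
  qed
qed

text \<open>In the subdivided multigraph, only the last edge of the path that replaces \<open>e\<close> jumps over
  original vertices. It lies on the page chosen for \<open>fst e\<close>, and the other edges of the path lie on
  the other page.\<close>

lemma planar_tree:
  fixes page :: "nat \<Rightarrow> bool"
  assumes ordered: "\<And>u b b'. (u, b) \<in> E0 \<Longrightarrow> (u, b') \<in> E0 \<Longrightarrow> b < b' \<Longrightarrow> hi (u, b') \<le> hi (u, b)"
    and nested: "\<And>e e'. e \<in> E0 \<Longrightarrow> e' \<in> E0 \<Longrightarrow> page (fst e) = page (fst e') \<Longrightarrow>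
      fst e < fst e' \<Longrightarrow> fst e' < hi e \<Longrightarrow> hi e' \<le> hi e"
  shows "planar_graph tree_verts tree_edges"
proof -
  define pg where "pg e i \<longleftrightarrow> (i = k) = page (fst e)" for e :: "nat \<times> nat" and i
  \<comment> \<open>A path edge has the same page in all copies; this is consistent because distinct
    copies share no edge and \<open>pedge\<close> is injective.\<close>
  define page' where "page' X \<longleftrightarrow> (\<exists>xs e i. e \<in> E0 \<and> i \<le> k \<and> X = place xs ` pedge e i \<and> pg e i)" for X
  have page': "page' (place xs ` pedge e i) \<longleftrightarrow> pg e i" if ei: "e \<in> E0" "i \<le> k" for xs e i
  proof
    assume "page' (place xs ` pedge e i)"
    then obtain xs' e' i' where *: "e' \<in> E0" "i' \<le> k"
      "place xs ` pedge e i = place xs' ` pedge e' i'" "pg e' i'"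
      by (auto simp: page'_def)
    have "place xs ` pedge e i \<in> copy xs" "place xs' ` pedge e' i' \<in> copy xs'"
      using ei * unfolding copy_def by (intro imageI pedge_in_sedges; simp)+
    then have "xs = xs'" using copy_disjoint *(3) by auto
    then have "pedge e i = pedge e' i'" using *(3) by (simp add: inj_image_eq_iff[OF inj_place])
    then show "pg e i" using inj_onD[OF inj_pedge, of "(e, i)" "(e', i')"] ei * by auto
  next
    assume "pg e i"
    then show "page' (place xs ` pedge e i)" unfolding page'_def using ei by blast
  qed
  have up: "pnode e i < pnode e (Suc i)" if "e \<in> E0" "i \<le> k" for e i
    using ends[OF that(1)] that(2) by (auto simp: pnode_def)
  \<comment> \<open>A first edge of a path can only be crossed by a last edge with the same lower
    end, which is on the other page, and a middle edge spans no node. Two last edges are excluded by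
    \<open>ordered\<close> if their lower ends agree and by \<open>nested\<close> otherwise.\<close>
  have core: False
    if e: "e \<in> E0" "i \<le> k" "e' \<in> E0" "i' \<le> k" "pg e i = pg e' i'"
      and less: "pnode e i < pnode e' i'" "pnode e' i' < pnode e (Suc i)"
        "pnode e (Suc i) < pnode e' (Suc i')"
    for e i e' i'
  proof -
    obtain u b u' b' where p: "e = (u, b)" "e' = (u', b')" by (metis prod.exhaust)
    have o: "hi (u, b') \<le> hi (u, b)" if "u = u'" "b < b'"
      using ordered[of u b b'] e p that by auto
    have ne: "hi (u', b') \<le> hi (u, b)" if "page u = page u'" "u < u'" "u' < hi (u, b)"
      using nested[OF e(1,3)] p that by auto
    consider "i = 0" | "0 < i" "i < k" | "i = k" using e(2) by linarith
    then show False
    proof cases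
      case 1
      then show False using e less p ends[OF e(1)] ends[OF e(3)] k_pos
        by (auto simp: pnode_def pg_def split: if_splits)
    next
      case 2
      then show False using e less p ends[OF e(1)] ends[OF e(3)] k_pos
        by (auto simp: pnode_def split: if_splits)
    next
      case 3
      show False
      proof (cases "i' = k")
        case True
        then show False using 3 e less p k_pos o ne
          by (auto simp: pnode_def pg_def split: if_splits)
      next
        case False
        then show False using 3 e less p ends[OF e(1)] ends[OF e(3)] k_pos
          by (auto simp: pnode_def split: if_splits)
      qed
    qed
  qed
  have edge: "\<exists>xs\<in>addresses. \<exists>e i. e \<in> E0 \<and> i \<le> k
      \<and> a = place xs (pnode e i) \<and> b = place xs (pnode e (Suc i))
      \<and> {a, b} = place xs ` pedge e i"
    if ab: "{a, b} \<in> tree_edges" "a < b" for a b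
  proof -
    obtain xs e i where *: "xs \<in> addresses" "e \<in> E0" "i \<le> k" "{a, b} = place xs ` pedge e i"
      using ab(1) by (auto simp: tree_edges_def copy_def sedges_def)
    then have "{a, b} = {place xs (pnode e i), place xs (pnode e (Suc i))}" by (simp add: pedge_def)
    moreover have "place xs (pnode e i) < place xs (pnode e (Suc i))"
      using up[OF *(2,3)] *(2) by (simp add: place_less_iff pnode_in_nodes)
    ultimately have "a = place xs (pnode e i)" "b = place xs (pnode e (Suc i))"
      using ab(2) by (auto simp: doubleton_eq_iff)
    then show ?thesis using * by blast
  qed
  show ?thesis
  proof (rule planar_graph_two_page[of _ _ page'])
    fix a b c d' assume E: "{a, b} \<in> tree_edges" "{c, d'} \<in> tree_edges" "page' {a, b} = page' {c, d'}"
      and less: "a < c" "c < b" "b < d'"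
    obtain xs e i where 1: "e \<in> E0" "i \<le> k"
      "a = place xs (pnode e i)" "b = place xs (pnode e (Suc i))"
      "{a, b} = place xs ` pedge e i"
      using edge[OF E(1)] less by (meson less_trans)
    obtain ys e' i' where 2: "e' \<in> E0" "i' \<le> k"
      "c = place ys (pnode e' i')" "d' = place ys (pnode e' (Suc i'))"
      "{c, d'} = place ys ` pedge e' i'"
      using edge[OF E(2)] less by (meson less_trans)
    have "xs = ys" using copies_noncrossing[OF _ 1(3,4) 2(3,4) less] by blast
    moreover have "pg e i = pg e' i'" using E(3) 1 2 page' by simp
    ultimately show False
      using core[OF 1(1,2) 2(1,2)] less 1 2 by (simp add: place_less_iff pnode_in_nodes)
  qed (rule ugraph_tree)
qed

text \<open>The cost and the penalty of the fractional solution are kept apart because the second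
  bound rescales the penalties.\<close>

lemma nat_instance:
  obtains J :: "nat pcsf" and x z where "pcsf_instance J" "0 < opt_LP J"
    "\<forall>F \<subseteq> edges J. real k / real (k + 1) - 1 / real m \<le> forest_cost J F + forest_penalty J F"
    "lp_feasible J x z" "(\<Sum>e\<in>edges J. cost J e * x e) = 1 / real d"
    "(\<Sum>i<npairs J. penalty J i * z i) \<le> (1 - 2 / real d) * (1 - real (n - 1) / real (card E0))"
    "planar_graph tree_verts tree_edges \<longrightarrow> planar_graph (verts J) (edges J)"
proof -
  define J where "J = relabel (to_nat :: nat list list \<Rightarrow> nat) tree_instance"
  note inj = inj_to_nat[where ?'a = "nat list list"]
  have J: "pcsf_instance J" unfolding J_def by (rule pcsf_instance_relabel[OF inj pcsf_instance_tree])
  have "0 < opt_LP J"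
  proof -
    obtain i where i: "i < npairs tree_instance" "0 < penalty tree_instance i"
      "src tree_instance i \<noteq> tgt tree_instance i"
      using tree_positive(2) by blast
    show ?thesis
    proof (rule opt_LP_pos[OF J])
      show "i < npairs J" "0 < penalty J i" "src J i \<noteq> tgt J i"
        using i inj by (auto simp: J_def relabel_def)
      show "0 < cost J e" if "e \<in> edges J" for e
        using that tree_positive(1) by (auto simp: J_def relabel_def inv_image[OF inj])
    qed
  qed
  moreover have "real k / real (k + 1) - 1 / real m \<le> forest_cost J F + forest_penalty J F"
    if F: "F \<subseteq> edges J" for F
  proof -
    obtain F' where "F' \<subseteq> edges tree_instance" "forest_cost J F = forest_cost tree_instance F'"
      "forest_penalty J F = forest_penalty tree_instance F'"
      using F unfolding J_def by (rule forest_relabel[OF inj])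
    then show ?thesis using forest_bound[of F'] by (simp add: \<sigma>_def)
  qed
  moreover have "(\<Sum>i<npairs J. penalty J i * tree_z i) \<le>
      (1 - 2 / real d) * (1 - real (n - 1) / real (card E0))"
    using lp_penalty_tree by (simp add: J_def relabel_def \<tau>_def)
  moreover have "planar_graph (verts J) (edges J)" if "planar_graph tree_verts tree_edges"
    unfolding J_def using that by (intro planar_graph_relabel[OF inj]) (simp add: tree_instance_def)
  ultimately show thesis
    using that[OF J _ _ lp_relabel(1)[OF inj lp_feasible_tree, folded J_def]]
      lp_relabel(2)[OF inj lp_feasible_tree, folded J_def] lp_cost_tree by simp
qed

end

subsection \<open>Prisms\<close>

text \<open>Column \<open>i < n\<close> of the prism consists of the vertices \<open>i\<close> and \<open>2 * n - 1 - i\<close>. The second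
  components \<open>0\<close>, \<open>1\<close>, \<open>2\<close> mark the rungs, the edges between the columns \<open>0\<close> and \<open>n - 1\<close>, and the
  edges between consecutive vertices.\<close>

definition prism :: "nat \<Rightarrow> (nat \<times> nat) set" where
  "prism n = (\<lambda>u. (u, 0)) ` {..<n} \<union> {(0, 1), (n, 1)} \<union> (\<lambda>u. (u, 2)) ` ({..<2 * n - 1} - {n - 1})"

definition prism_hi :: "nat \<Rightarrow> nat \<times> nat \<Rightarrow> nat" where
  "prism_hi n = (\<lambda>(u, b). if b = 0 then 2 * n - 1 - u else if b = 1 then u + n - 1 else u + 1)"

lemma finite_prism: "finite (prism n)"
  by (simp add: prism_def)

text \<open>There are n rungs and two cycles of length n. The bound makes \<tau> at least (2 * n -
  1) / (3 * n).\<close>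

lemma card_prism_le:
  assumes "3 \<le> n"
  shows "card (prism n) \<le> 3 * n"
proof -
  have "card (prism n) \<le> card ((\<lambda>u. (u, 0 :: nat)) ` {..<n}) + card {(0 :: nat, 1 :: nat), (n, 1)} +
      card ((\<lambda>u. (u, 2 :: nat)) ` ({..<2 * n - 1} - {n - 1}))"
    unfolding prism_def by (intro order_trans[OF card_Un_le] add_mono card_Un_le order_refl)
  also have "\<dots> \<le> n + 2 + (2 * n - 1 - 1)"
    using assms by (intro add_mono order_trans[OF card_image_le]) (auto simp: card_Diff_subset)
  finally show ?thesis using assms by simp
qed

text \<open>Every vertex but the last one is the lower end of some edge.\<close>

lemma card_prism_ge:
  assumes "3 \<le> n"
  shows "2 * n - 1 \<le> card (prism n)"
proof -
  have "u \<in> fst ` prism n" if "u < 2 * n - 1" for u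
  proof (cases "u = n - 1")
    case True
    then have "(u, 0) \<in> prism n" using assms by (auto simp: prism_def)
    then show ?thesis by force
  next
    case False
    then have "(u, 2) \<in> prism n" using that by (auto simp: prism_def)
    then show ?thesis by force
  qed
  then have "card {..<2 * n - 1} \<le> card (fst ` prism n)"
    by (intro card_mono) (auto simp: finite_prism)
  also have "\<dots> \<le> card (prism n)" by (rule card_image_le[OF finite_prism])
  finally show ?thesis by simp
qed

lemma two_changes_cyclic:
  fixes P :: "nat \<Rightarrow> bool"
  assumes "a < n" "b < n" "P a \<noteq> P b"
  obtains i j where "i < n" "j < n" "i \<noteq> j" "P i \<noteq> P (Suc i mod n)" "P j \<noteq> P (Suc j mod n)"
proof -
  have *: "\<exists>i j. i < n \<and> j < n \<and> i \<noteq> j \<and> P i \<noteq> P (Suc i mod n) \<and> P j \<noteq> P (Suc j mod n)"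
    if "a < b" "b < n" "P a \<noteq> P b" for a b
  proof -
    obtain i where i: "a \<le> i" "i < b" "P i \<noteq> P (Suc i)"
      using ex_change_between[of a b P] \<open>a < b\<close> \<open>P a \<noteq> P b\<close> by auto
    \<comment> \<open>Besides the change between a and b there is one at the wrap-around from n - 1
      to 0, or one before a, or one from b on.\<close>
    have "\<exists>j<n. i \<noteq> j \<and> P j \<noteq> P (Suc j mod n)"
    proof (cases "P 0 = P a \<and> P (n - 1) = P b")
      case True
      then have "P (n - 1) \<noteq> P (Suc (n - 1) mod n)" using \<open>P a \<noteq> P b\<close> \<open>b < n\<close> by simp
      then show ?thesis using i \<open>b < n\<close> by (intro exI[of _ "n - 1"]) auto
    next
      case False
      then consider "P 0 \<noteq> P a" | "P b \<noteq> P (n - 1)" by auto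
      then show ?thesis
      proof cases
        case 1
        then obtain j where "j < a" "P j \<noteq> P (Suc j)" using ex_change_between[of 0 a P] by auto
        then show ?thesis using i \<open>b < n\<close> by (intro exI[of _ j]) auto
      next
        case 2
        have "b \<le> n - 1" using \<open>b < n\<close> by simp
        then obtain j where "b \<le> j" "j < n - 1" "P j \<noteq> P (Suc j)"
          using ex_change_between[of b "n - 1" P] 2 by blast
        then show ?thesis using i by (intro exI[of _ j]) auto
      qed
    qed
    moreover have "Suc i mod n = Suc i" using i \<open>b < n\<close> by simp
    ultimately show ?thesis using i \<open>b < n\<close> by (metis less_trans)
  qed
  have "a \<noteq> b" using assms(3) by blast
  then consider "a < b" | "b < a" by linarith
  then show thesis using *[of a b] *[of b a] assms that by cases blast+
qed

text \<open>If no rung is cut, both cycles show the same pattern and each is cut twice; if all rungs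
  are cut, there are at least three. Otherwise one rung is cut, and the agreement of the two rows
  changes at two places around the cycle, each time cutting an edge of one of the rows.\<close>

lemma prism_edge_connected:
  assumes n: "3 \<le> n" and xy: "x < 2 * n" "y < 2 * n" "x \<in> S" "y \<notin> S"
  shows "3 \<le> card {e \<in> prism n. (fst e \<in> S) \<noteq> (prism_hi n e \<in> S)}" (is "_ \<le> card ?C")
proof -
  define T where "T i \<longleftrightarrow> i \<in> S" for i
  define B where "B i \<longleftrightarrow> 2 * n - 1 - i \<in> S" for i
  \<comment> \<open>\<open>top i\<close> and \<open>bot i\<close> are the edges from column i to the
    cyclically next column in the two rows; tag 1 marks the wrap-around.\<close>
  define top where "top i = (if i < n - 1 then (i, 2) else (0, 1 :: nat))" for i
  define bot where "bot i = (if i < n - 1 then (2 * n - 2 - i, 2) else (n, 1 :: nat))" for i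
  have fin: "finite ?C" by (simp add: finite_prism)
  have top: "top i \<in> ?C" if "i < n" "T i \<noteq> T (Suc i mod n)" for i
  proof (cases "i < n - 1")
    case True
    then have "Suc i mod n = Suc i" by simp
    then show ?thesis using that True by (auto simp: top_def T_def prism_def prism_hi_def)
  next
    case False
    then have "i = n - 1" "Suc i mod n = 0" using that by (auto simp: le_less Suc_diff_Suc mod_if)
    then show ?thesis using that n by (auto simp: top_def T_def prism_def prism_hi_def)
  qed
  have bot: "bot i \<in> ?C" if "i < n" "B i \<noteq> B (Suc i mod n)" for i
  proof (cases "i < n - 1")
    case True
    then have "Suc i mod n = Suc i" "2 * n - 1 - i = 2 * n - 2 - i + 1"
      "2 * n - 1 - Suc i = 2 * n - 2 - i"
      by auto
    then show ?thesis using that True n by (auto simp: bot_def B_def prism_def prism_hi_def)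
  next
    case False
    then have "i = n - 1" "Suc i mod n = 0" using that by (auto simp: mod_if)
    moreover have "2 * n - 1 - (n - 1) = n" "n + n - 1 = 2 * n - 1" using n by auto
    ultimately show ?thesis using that n by (auto simp: bot_def B_def prism_def prism_hi_def)
  qed
  have rung: "(i, 0) \<in> ?C" if "i < n" "T i \<noteq> B i" for i
    using that by (auto simp: T_def B_def prism_def prism_hi_def)
  have three: "3 \<le> card ?C" if "p \<in> ?C" "q \<in> ?C" "r \<in> ?C" "p \<noteq> q" "p \<noteq> r" "q \<noteq> r" for p q r
  proof -
    have "card {p, q, r} = 3" using that by simp
    moreover have "card {p, q, r} \<le> card ?C" using that by (intro card_mono fin) simp
    ultimately show ?thesis by simp
  qed
  have top_inj: "top i \<noteq> top j" and bot_inj: "bot i \<noteq> bot j" and top_bot: "top i \<noteq> bot j"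
    if "i < n" "j < n" "i \<noteq> j" for i j
    using that n by (auto simp: top_def bot_def)
  consider "\<forall>i<n. T i = B i" | "\<forall>i<n. T i \<noteq> B i"
    | i j where "i < n" "j < n" "T i = B i" "T j \<noteq> B j" by blast
  then show ?thesis
  proof cases
    case 1
    define col where "col v = (if v < n then v else 2 * n - 1 - v)" for v
    have col: "col v < n" "T (col v) \<longleftrightarrow> v \<in> S" if "v < 2 * n" for v
      using 1 that by (auto simp: col_def T_def B_def)
    obtain i j where ij: "i < n" "j < n" "i \<noteq> j" "T i \<noteq> T (Suc i mod n)" "T j \<noteq> T (Suc j mod n)"
      using two_changes_cyclic[of "col x" n "col y" T] col xy by auto
    have "B i \<noteq> B (Suc i mod n)" using 1 ij by simp
    moreover have "top i \<noteq> bot i" using ij(1) n by (auto simp: top_def bot_def)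
    ultimately show ?thesis
      using three[of "top i" "top j" "bot i"] top bot ij top_inj[of i j] top_bot[of j i] by auto
  next
    case 2
    then show ?thesis using three[of "(0, 0)" "(1, 0)" "(2, 0)"] rung n by simp
  next
    case (3 r s)
    obtain i j where ij: "i < n" "j < n" "i \<noteq> j" "(T i = B i) \<noteq> (T (Suc i mod n) = B (Suc i mod n))"
      "(T j = B j) \<noteq> (T (Suc j mod n) = B (Suc j mod n))"
      using two_changes_cyclic[of r n s "\<lambda>i. T i = B i"] 3 by auto
    then have "top i \<in> ?C \<or> bot i \<in> ?C" "top j \<in> ?C \<or> bot j \<in> ?C" using top bot by blast+
    then obtain p q where "p \<in> ?C" "p = top i \<or> p = bot i" "q \<in> ?C" "q = top j \<or> q = bot j" by blast
    moreover have "(s, 0) \<noteq> top l" "(s, 0) \<noteq> bot l" for l by (auto simp: top_def bot_def)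
    ultimately show ?thesis
      using three[of p q "(s, 0)"] rung[OF 3(2,4)]
        top_inj[OF ij(1-3)] bot_inj[OF ij(1-3)] top_bot[OF ij(1-3)]
        top_bot[of j i] ij(1-3) by metis
  qed
qed

lemma multigraph_prism:
  assumes "3 \<le> n" "0 < k"
  shows "multigraph (2 * n) (prism n) (prism_hi n) 3 k"
proof
  show "fst e < prism_hi n e" "prism_hi n e < 2 * n" if "e \<in> prism n" for e
    using that assms by (auto simp: prism_def prism_hi_def)
qed (use assms finite_prism prism_edge_connected card_prism_ge in auto)

text \<open>The rungs are nested, but the closing edges from 0 to n - 1 and from n to 2 * n - 1
  cross the rungs of the middle columns. Edges with lower end 0 or n therefore use a page of their
  own.\<close>

lemma prism_two_page:
  assumes n: "3 \<le> n" and e: "e \<in> prism n" "e' \<in> prism n"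
    and page: "(fst e \<in> {0, n}) = (fst e' \<in> {0, n})" and less: "fst e < fst e'" "fst e' < prism_hi n e"
  shows "prism_hi n e' \<le> prism_hi n e"
  using assms by (auto simp: prism_def prism_hi_def)

text \<open>The tags 0, 1, 2 go from long edges to short ones, so that edges from a common lower end
  nest after subdivision.\<close>

lemma prism_ordered:
  assumes "3 \<le> n" "(u, b) \<in> prism n" "(u, b') \<in> prism n" "b < b'"
  shows "prism_hi n (u, b') \<le> prism_hi n (u, b)"
  using assms by (auto simp: prism_def prism_hi_def)

subsection \<open>Complete graphs\<close>

definition complete :: "nat \<Rightarrow> (nat \<times> nat) set" where
  "complete n = (SIGMA u : {..<n}. {..<n - 1 - u})"

definition complete_hi :: "nat \<times> nat \<Rightarrow> nat" where
  "complete_hi = (\<lambda>(u, b). u + b + 1)"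

lemma card_complete: "2 * card (complete n) = n * (n - 1)"
proof -
  have "card (complete n) = (\<Sum>u<n. n - 1 - u)" by (simp add: complete_def)
  also have "\<dots> = (\<Sum>u<n. u)"
    using sum.nat_diff_reindex[of "\<lambda>u. u" n] by simp
  also have "2 * \<dots> = n * (n - 1)"
    by (induction n) (auto simp: algebra_simps)
  finally show ?thesis .
qed

text \<open>Every vertex other than x contributes its edge to y if it lies in S, and its edge to x
  otherwise; these n - 1 edges are distinct and all cut.\<close>

lemma complete_edge_connected:
  assumes xy: "x < n" "y < n" "x \<in> S" "y \<notin> S"
  shows "n - 1 \<le> card {e \<in> complete n. (fst e \<in> S) \<noteq> (complete_hi e \<in> S)}" (is "_ \<le> card ?C")
proof -
  define edge where "edge u v = (min u v, max u v - min u v - 1)" for u v :: nat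
  have edge: "edge u v \<in> ?C" if uv: "u < n" "v < n" "(u \<in> S) \<noteq> (v \<in> S)" for u v
  proof -
    have "u \<noteq> v" using uv(3) by blast
    then have "min u v < max u v" by linarith
    then have "complete_hi (edge u v) = max u v" by (simp add: edge_def complete_hi_def)
    moreover have "edge u v \<in> complete n"
      using uv(1,2) \<open>min u v < max u v\<close> unfolding edge_def complete_def by simp linarith
    ultimately show ?thesis using uv(3) by (auto simp: edge_def min_def max_def)
  qed
  have edge_eq: "{u, v} = {u', v'}" if "edge u v = edge u' v'" "u \<noteq> v" "u' \<noteq> v'" for u v u' v'
    using that by (auto simp: edge_def min_def max_def split: if_splits)
  define f where "f v = (if v \<in> S then edge v y else edge v x)" for v
  have "inj_on f ({..<n} - {x})"
  proof (rule inj_onI)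
    fix v w assume vw: "v \<in> {..<n} - {x}" "w \<in> {..<n} - {x}" "f v = f w"
    show "v = w"
      using edge_eq[of v "if v \<in> S then y else x" w "if w \<in> S then y else x"] vw xy
      by (auto simp: f_def doubleton_eq_iff split: if_splits)
  qed
  moreover have "f ` ({..<n} - {x}) \<subseteq> ?C" using edge xy by (auto simp: f_def)
  moreover have "finite ?C" by (simp add: complete_def)
  ultimately have "card ({..<n} - {x}) \<le> card ?C" by (rule card_inj_on_le)
  then show ?thesis using xy(1) by simp
qed

lemma multigraph_complete:
  assumes "2 \<le> d" "0 < k"
  shows "multigraph (d + 1) (complete (d + 1)) complete_hi d k"
proof
  show "finite (complete (d + 1))" by (simp add: complete_def)
  show "fst e < complete_hi e" "complete_hi e < d + 1" if "e \<in> complete (d + 1)" for e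
    using that by (auto simp: complete_def complete_hi_def)
  show "d \<le> card {e \<in> complete (d + 1). (fst e \<in> S) \<noteq> (complete_hi e \<in> S)}"
    if "x < d + 1" "y < d + 1" "x \<in> S" "y \<notin> S" for x y S
    using complete_edge_connected[OF that] by simp
  have "2 * (d + 1 - 1) \<le> 2 * card (complete (d + 1))" unfolding card_complete using assms(1) by simp
  then show "d + 1 - 1 \<le> card (complete (d + 1))" by linarith
qed (use assms in auto)

subsection \<open>The two bounds\<close>

text \<open>With subdivision length and depth both equal to x, each of the two error terms is at
  most 1 / x.\<close>

lemma subdivision_loss:
  fixes x :: real
  assumes "0 < x"
  shows "1 - 2 / x \<le> x / (x + 1) - 1 / x"
proof -
  have "x / (x + 1) = 1 - 1 / (x + 1)" using assms by (simp add: field_simps)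
  moreover have "1 / (x + 1) \<le> 1 / x" using assms by (simp add: frac_le)
  moreover have "2 / x = 1 / x + 1 / x" by simp
  ultimately show ?thesis by linarith
qed

lemma planar_gap_instance:
  assumes n: "3 \<le> n"
  shows "\<exists>J :: nat pcsf. pcsf_instance J \<and> planar_graph (verts J) (edges J) \<and> 0 < opt_LP J \<and>
    (1 - 2 / real n) / (4 / 9 + 1 / (9 * real n)) \<le> opt_IP J / opt_LP J"
proof -
  interpret copy_tree "2 * n" "prism n" "prism_hi n" 3 n n
    using multigraph_prism[of n n] n by (simp add: copy_tree_def copy_tree_axioms_def)
  have planar: "planar_graph tree_verts tree_edges"
    using prism_ordered[OF n] prism_two_page[OF n] by (rule planar_tree[where page = "\<lambda>u. u \<in> {0, n}"])
  obtain J :: "nat pcsf" and x z where J: "pcsf_instance J" "0 < opt_LP J"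
    and IP: "\<forall>F \<subseteq> edges J. real n / real (n + 1) - 1 / real n \<le> forest_cost J F + forest_penalty J F"
    and LP: "lp_feasible J x z" "(\<Sum>e\<in>edges J. cost J e * x e) = 1 / real 3"
      "(\<Sum>i<npairs J. penalty J i * z i) \<le>
        (1 - 2 / real 3) * (1 - real (2 * n - 1) / real (card (prism n)))"
    and "planar_graph tree_verts tree_edges \<longrightarrow> planar_graph (verts J) (edges J)"
    by (rule nat_instance)
  then have plJ: "planar_graph (verts J) (edges J)" using planar by blast
  have "1 - 2 / real n \<le> real n / real (n + 1) - 1 / real n"
    using subdivision_loss[of "real n"] n by (simp add: add.commute)
  also have "\<dots> \<le> opt_IP J" using IP by (intro opt_IP_ge[OF J(1)]) blast
  finally have 1: "1 - 2 / real n \<le> opt_IP J" .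
  \<comment> \<open>Here \<tau> is at least 2 / 3 - 1 / (3 * n), so the LP value is at most 1 / 3 +
    (1 / 3) * (1 / 3 + 1 / (3 * n)).\<close>
  have "real (card (prism n)) \<le> 3 * real n" "0 < card (prism n)"
    using card_prism_le[OF n] card_prism_ge[OF n] n by linarith+
  then have "real (2 * n - 1) / (3 * real n) \<le> real (2 * n - 1) / real (card (prism n))"
    using n by (intro divide_left_mono) auto
  moreover have "real (2 * n - 1) / (3 * real n) = 2 / 3 - 1 / (3 * real n)"
    using n by (simp add: of_nat_diff field_simps)
  ultimately have "(1 - 2 / real 3) * (1 - real (2 * n - 1) / real (card (prism n)))
      \<le> 1 / 9 + 1 / (9 * real n)"
    by (simp add: field_simps)
  then have "lp_value J x z \<le> 4 / 9 + 1 / (9 * real n)"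
    unfolding lp_value_def using LP(2,3) by simp
  then have 2: "opt_LP J \<le> 4 / 9 + 1 / (9 * real n)"
    using opt_LP_le[OF J(1) LP(1)] by linarith
  have "0 \<le> 1 - 2 / real n" using n by simp
  then have "(1 - 2 / real n) / (4 / 9 + 1 / (9 * real n)) \<le> opt_IP J / opt_LP J"
    using 1 2 J(2) by (intro frac_le) auto
  then show ?thesis using J plJ by blast
qed

text \<open>With penalties divided by \<beta>, the guarantee compares c(F) + \<pi>(F) in the
  original instance, which is about 1, with \<beta> / d plus the original LP penalty. Solving for
  \<beta> gives a bound that tends to 4.\<close>

lemma lmp_bound:
  fixes \<beta> :: real
  assumes \<beta>: "0 < \<beta>" and d: "2 \<le> d"
    and lmp: "\<And>J :: nat pcsf. pcsf_instance J \<Longrightarrow>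
      \<exists>F. forest_in (edges J) F \<and> forest_cost J F + \<beta> * forest_penalty J F \<le> \<beta> * opt_LP J"
  shows "4 - 6 / real (d + 1) - 2 / real d \<le> \<beta>"
proof -
  \<comment> \<open>The final inequality is multiplied by d, so the error has to be of order 1 /
    d^2; hence length and depth d * d.\<close>
  interpret copy_tree "d + 1" "complete (d + 1)" complete_hi d "d * d" "d * d"
    using multigraph_complete[of d "d * d"] d by (simp add: copy_tree_def copy_tree_axioms_def)
  obtain J :: "nat pcsf" and x z where J: "pcsf_instance J" and "0 < opt_LP J"
    and IP: "\<forall>F \<subseteq> edges J.
      real (d * d) / real (d * d + 1) - 1 / real (d * d) \<le> forest_cost J F + forest_penalty J F"
    and LP: "lp_feasible J x z" "(\<Sum>e\<in>edges J. cost J e * x e) = 1 / real d"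
      "(\<Sum>i<npairs J. penalty J i * z i) \<le>
        (1 - 2 / real d) * (1 - real (d + 1 - 1) / real (card (complete (d + 1))))"
    and "planar_graph tree_verts tree_edges \<longrightarrow> planar_graph (verts J) (edges J)"
    by (rule nat_instance)
  define J' where "J' = J\<lparr>penalty := \<lambda>i. penalty J i / \<beta>\<rparr>"
  have J': "pcsf_instance J'" using J \<beta> by (simp add: pcsf_instance_def J'_def)
  obtain F where F: "F \<subseteq> edges J" "forest_cost J' F + \<beta> * forest_penalty J' F \<le> \<beta> * opt_LP J'"
    using lmp[OF J'] by (auto simp: forest_in_def J'_def)
  have cost: "forest_cost J' F = forest_cost J F"
    by (simp add: forest_cost_def J'_def)
  have pen: "\<beta> * forest_penalty J' F = forest_penalty J F"
    using \<beta> by (simp add: forest_penalty_def J'_def sum_distrib_left)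
  have "lp_feasible J' x z" using LP(1)
    by (simp add: lp_feasible_def J'_def cut_def separates_def)
  then have "opt_LP J' \<le> lp_value J' x z" by (rule opt_LP_le[OF J'])
  then have "\<beta> * opt_LP J' \<le> \<beta> * lp_value J' x z" using \<beta> by simp
  also have "\<dots> = \<beta> * (\<Sum>e\<in>edges J. cost J e * x e) + (\<Sum>i<npairs J. penalty J i * z i)"
    using \<beta> by (simp add: lp_value_def J'_def distrib_left sum_distrib_left)
  finally have *: "real (d * d) / real (d * d + 1) - 1 / real (d * d) \<le>
      \<beta> / real d + (1 - 2 / real d) * (1 - real (d + 1 - 1) / real (card (complete (d + 1))))"
    using IP[rule_format, OF F(1)] F(2) LP(2,3) unfolding cost pen by simp
  define r where "r = real d"
  have r: "2 \<le> r" using d by (simp add: r_def)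
  have "real (2 * card (complete (d + 1))) = real ((d + 1) * d)" by (simp only: card_complete) simp
  then have card: "real (card (complete (d + 1))) = (r + 1) * r / 2"
    by (simp add: r_def algebra_simps)
  have "real (d + 1 - 1) = r" by (simp add: r_def)
  then have "real (d + 1 - 1) / real (card (complete (d + 1))) = 2 / (r + 1)"
    unfolding card using r by (simp add: divide_simps)
  then have "r * r / (r * r + 1) - 1 / (r * r) \<le> \<beta> / r + (1 - 2 / r) * (1 - 2 / (r + 1))"
    using * unfolding \<open>real (d + 1 - 1) / real (card (complete (d + 1))) = 2 / (r + 1)\<close>
    by (simp add: r_def add.commute)
  moreover have "1 - 2 / (r * r) \<le> r * r / (r * r + 1) - 1 / (r * r)"
    using r by (intro subdivision_loss) simp
  ultimately have "1 - 2 / (r * r) - (1 - 2 / r) * (1 - 2 / (r + 1)) \<le> \<beta> / r" by linarith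
  then have "r * (1 - 2 / (r * r) - (1 - 2 / r) * (1 - 2 / (r + 1))) \<le> r * (\<beta> / r)"
    using r by (intro mult_left_mono) auto
  moreover have "r * (1 - 2 / (r * r) - (1 - 2 / r) * (1 - 2 / (r + 1))) = 4 - 6 / (r + 1) - 2 / r"
    using r by (simp add: divide_simps) (simp add: algebra_simps)
  moreover have "r * (\<beta> / r) = \<beta>" using r by simp
  ultimately show ?thesis by (simp add: r_def add.commute)
qed

theorem theorem1:
  "(SUP J \<in> {J :: nat pcsf. pcsf_instance J \<and> planar_graph (verts J) (edges J) \<and> 0 < opt_LP J}.
      ereal (opt_IP J / opt_LP J)) \<ge> ereal (9 / 4)
   \<and>
   (\<forall>\<beta> :: real. 0 < \<beta> \<longrightarrow>
      (\<forall>J :: nat pcsf. pcsf_instance J \<longrightarrow>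
         (\<exists>F. forest_in (edges J) F \<and>
            forest_cost J F + \<beta> * forest_penalty J F \<le> \<beta> * opt_LP J)) \<longrightarrow>
      4 \<le> \<beta>)"
proof (intro conjI allI impI)
  let ?A = "{J :: nat pcsf. pcsf_instance J \<and> planar_graph (verts J) (edges J) \<and> 0 < opt_LP J}"
  let ?f = "\<lambda>n. (1 - 2 / real n) / (4 / 9 + 1 / (9 * real n))"
  have "?f \<longlonglongrightarrow> 9 / 4" by real_asymp
  then have "(\<lambda>n. ereal (?f n)) \<longlonglongrightarrow> ereal (9 / 4)" by simp
  then show "ereal (9 / 4) \<le> (SUP J \<in> ?A. ereal (opt_IP J / opt_LP J))"
  proof (rule LIMSEQ_le_const2, intro exI[of _ 3] allI impI)
    fix n :: nat assume "3 \<le> n"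
    then obtain J where "J \<in> ?A" "?f n \<le> opt_IP J / opt_LP J" using planar_gap_instance by blast
    then show "ereal (?f n) \<le> (SUP J \<in> ?A. ereal (opt_IP J / opt_LP J))"
      by (intro SUP_upper2[of J]) auto
  qed
next
  fix \<beta> :: real
  assume "0 < \<beta>" and "\<forall>J :: nat pcsf. pcsf_instance J \<longrightarrow>
    (\<exists>F. forest_in (edges J) F \<and> forest_cost J F + \<beta> * forest_penalty J F \<le> \<beta> * opt_LP J)"
  then have "4 - 6 / real (d + 1) - 2 / real d \<le> \<beta>" if "2 \<le> d" for d
    using lmp_bound that by blast
  moreover have "(\<lambda>d. 4 - 6 / real (d + 1) - 2 / real d) \<longlonglongrightarrow> 4" by real_asymp
  ultimately show "4 \<le> \<beta>" by (intro LIMSEQ_le_const2) auto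
qed

end
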